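(* Let $F\in\mathfrak F$, let $u\in W_1^1(-1,1)$ be non-negative with $u(-1)=0$, and let $\mathfrak a:[-1,1]\times\mathbb R_+\to\mathbb R_+$ be a continuous function satisfying $$\mathfrak a(s,v)+\mathfrak a(t,v)\ge\mathfrak a(1-t+s,v)\qquad\text{for all } -1\le s\le t\le1,\ v\in\mathbb R_+ .$$ Then $I(\mathfrak a,u^* )\le I(\mathfrak a,u)$.
   Context: $\mathbb R_+=[0,\infty)$. $\mathfrak F$ is the set of continuous functions $F:\mathbb R_+\times\mathbb R_+\to\mathbb R_+$ that are convex and strictly increasing with respect to the second argument. For $F\in\mathfrak F$, a continuous weight $\mathfrak a:[-1,1]\times\mathbb R_+\to\mathbb R_+$ and a non-negative $u\in W_1^1(-1,1)$ (absolutely continuous functions on $[-1,1]$), $$I(\mathfrak a,u)=\int_{-1}^1 F\big(u(x),\mathfrak a(x,u(x))\,|u'(x)|\big)\,dx\in[0,\infty].$$ The monotone rearrangement of a measurable set $E\subset[-1,1]$ is $E^*=[1-|E|,1]$, with $|E|$ the Lebesgue measure and $\emptyset^*=\emptyset$. For non-negative $u\in W_1^1(-1,1)$, with $\mathcal A_t=\{x\in[-1,1]:u(x)>t\}$, the monotone rearrangement of $u$ is $u^*(x)=\int_0^\infty\chi_{\mathcal A_t^*}(x)\,dt$; it is a non-decreasing function in $W_1^1(-1,1)$. *)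

theory Defs
  imports "HOL-Analysis.Analysis"
begin

(* Functions on [-1,1] and on [0,\<infinity>) are represented by total functions on the reals; all
   hypotheses constrain them on the original domains only. *)

definition abs_cont_on :: "real set \<Rightarrow> (real \<Rightarrow> real) \<Rightarrow> bool" where
  "abs_cont_on S f \<longleftrightarrow>
     (\<forall>\<epsilon>>0. \<exists>\<delta>>0. \<forall>P :: (real \<times> real) set.
        finite P \<and>
        (\<forall>(c, d)\<in>P. c < d \<and> {c..d} \<subseteq> S) \<and>
        disjoint_family_on (\<lambda>(c, d). {c<..<d}) P \<and>
        (\<Sum>(c, d)\<in>P. d - c) < \<delta>
        \<longrightarrow> (\<Sum>(c, d)\<in>P. \<bar>f d - f c\<bar>) < \<epsilon>)"

definition integrand_class :: "(real \<Rightarrow> real \<Rightarrow> real) set" where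
  "integrand_class = {F.
     continuous_on ({0..} \<times> {0..}) (\<lambda>(v, p). F v p) \<and>
     (\<forall>v\<ge>0. \<forall>p\<ge>0. F v p \<ge> 0) \<and>
     (\<forall>v\<ge>0. convex_on {0..} (F v) \<and> strict_mono_on {0..} (F v))}"

(* For absolutely continuous u the derivative exists almost everywhere on [-1,1]; the arbitrary
   value of deriv at the remaining points (and the values at the two endpoints, which depend on
   u outside [-1,1]) do not influence the integral. *)

definition weighted_functional ::
    "(real \<Rightarrow> real \<Rightarrow> real) \<Rightarrow> (real \<Rightarrow> real \<Rightarrow> real) \<Rightarrow> (real \<Rightarrow> real) \<Rightarrow> ennreal" where
  "weighted_functional F a u =
     (\<integral>\<^sup>+x\<in>{-1..1}. ennreal (F (u x) (a x (u x) * \<bar>deriv u x\<bar>)) \<partial>lborel)"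

definition set_rearrangement :: "real set \<Rightarrow> real set" where
  "set_rearrangement E = (if E = {} then {} else {1 - measure lebesgue E..1})"

definition superlevel :: "(real \<Rightarrow> real) \<Rightarrow> real \<Rightarrow> real set" where
  "superlevel u t = {x \<in> {-1..1}. u x > t}"

definition monotone_rearrangement :: "(real \<Rightarrow> real) \<Rightarrow> real \<Rightarrow> real" where
  "monotone_rearrangement u x =
     (LINT t:{0..}|lborel. indicator (set_rearrangement (superlevel u t)) x)"

end

theory Submission
  imports Defs
begin

text \<open>
Write \<open>u*\<close> for the rearrangement and \<open>F(v, p) = F(v, 0) + G(v, p)\<close>. The part \<open>F(v, 0)\<close> contributes
equally to both functionals, because \<open>u\<close> and \<open>u*\<close> have the same distribution
(\<open>rearrangement_equimeasurable\<close>). The rest, \<open>G\<close>, vanishes at zero slope, so only the points with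
nonzero derivative count, and there the functional can be computed level by level (the coarea
formula):
  \<open>\<integral> G(u, a |u'|) dx = \<integral> (\<Sum> over u(z) = t of G(t, a(z,t) |u'(z)|) / |u'(z)|) dt\<close>.
For the monotone function \<open>u*\<close> the inner sum has a single term, so it suffices to compare that term
with the sum at almost every level \<open>t\<close>; this is \<open>level_inequality\<close>.

For almost every \<open>t\<close> the function \<open>u\<close> is differentiable with nonzero derivative at each point of the
level set \<open>Z\<close>: the points of non-differentiability form a null set, which an absolutely continuous
function maps to a null set, and the critical values form a null set too. Hence \<open>Z\<close> is finite and
\<open>u\<close> crosses \<open>t\<close> at each of its points. Three facts then give the comparison.
 \<^item> \<open>u*\<close> takes the value \<open>t\<close> at \<open>x = 1 - |{u > t}|\<close>. Since \<open>u\<close> starts below \<open>t\<close>, this \<open>x\<close> is the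
   alternating sum of the points of \<open>Z\<close>, increased by 1 if \<open>u\<close> ends below \<open>t\<close>. The condition on the
   weight is exactly what makes \<open>a(x, t) \<le> (\<Sum> over Z of a(z, t))\<close> follow by cancelling
   neighbouring points (\<open>sum_crossing_weights_ge\<close>).
 \<^item> Below each point of \<open>Z\<close> the superlevel set grows at rate \<open>1 / |u'(z)|\<close> as the level decreases,
   hence \<open>u*'(x) (\<Sum> over Z of 1 / |u'(z)|) \<le> 1\<close> (\<open>rearrangement_slope_le\<close>).
 \<^item> Jensen's inequality with weights proportional to \<open>1 / |u'(z)|\<close> turns these two inequalities into
   the comparison of the values of \<open>G\<close> (\<open>convex_harmonic_sum_le\<close>).

The proof rests on Lebesgue's theorem that monotone functions are differentiable almost everywhere.
It applies to \<open>u*\<close> directly, and to \<open>u\<close> because an absolutely continuous function is locally a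
difference of two monotone functions.
\<close>

section \<open>Differentiability of monotone functions\<close>

lemma negligible_of_outer_measure_zero:
  assumes "outer_measure_of lebesgue E = 0"
  shows "negligible (E :: real set)"
proof -
  obtain B where "B \<in> sets lebesgue" "E \<subseteq> B" "outer_measure_of lebesgue E = emeasure lebesgue B"
    using outer_measure_of_attain[of E lebesgue] by auto
  with assms have "negligible B"
    by (simp add: negligible_iff_null_sets null_sets_def)
  then show ?thesis using \<open>E \<subseteq> B\<close> negligible_subset by blast
qed

text \<open>
Images and preimages under a monotone function are treated symmetrically here: each index carries
an interval on the side of \<open>E\<close> and a partner interval on the side of \<open>E'\<close>. Vitali's theorem picks
disjoint intervals that exhaust \<open>E\<close> up to a null set. Their partners are disjoint as well and lie in
an open set of measure close to that of \<open>E'\<close>, and they are longer by the factor \<open>q\<close>.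
Outer measure is used because the sets on which difference quotients are large or small are not
known to be measurable.
\<close>
lemma vitali_outer_measure_comparison:
  fixes l r l' r' :: "'i \<Rightarrow> real"
  assumes nondeg: "\<And>i. i \<in> K \<Longrightarrow> l i < r i \<and> l' i \<le> r' i"
    and ratio: "\<And>i. i \<in> K \<Longrightarrow> q * (r i - l i) \<le> r' i - l' i" and q: "0 \<le> q"
    and disj: "\<And>i j. i \<in> K \<Longrightarrow> j \<in> K \<Longrightarrow> disjnt {l i..r i} {l j..r j} \<Longrightarrow>
                 disjnt {l' i..r' i} {l' j..r' j}"
    and cover: "\<And>x V d. x \<in> E \<Longrightarrow> open V \<Longrightarrow> E' \<subseteq> V \<Longrightarrow> 0 < d \<Longrightarrow>
                 \<exists>i\<in>K. x \<in> {l i..r i} \<and> r i - l i < d \<and> {l' i..r' i} \<subseteq> V"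
  shows "ennreal q * outer_measure_of lebesgue E \<le> outer_measure_of lebesgue E'"
proof -
  have main: "ennreal q * outer_measure_of lebesgue E \<le> emeasure lebesgue B + ennreal e"
    if B: "B \<in> sets lebesgue" "E' \<subseteq> B" and e: "e > 0" for B and e :: real
  proof -
    obtain V where V: "open V" "B \<subseteq> V" "V - B \<in> lmeasurable" "emeasure lebesgue (V - B) < ennreal e"
      using sets_lebesgue_outer_open[OF B(1) e] by blast
    let ?K = "{i \<in> K. {l' i..r' i} \<subseteq> V}"
    let ?cball = "\<lambda>i. cball ((l i + r i) / 2) ((r i - l i) / 2)"
    have ball: "?cball i = {l i..r i}" for i
      by (auto simp: cball_eq_atLeastAtMost field_simps)
    obtain C where C: "countable C" "C \<subseteq> ?K"
      and pw: "pairwise (\<lambda>i j. disjnt (?cball i) (?cball j)) C"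
      and neg: "negligible (E - (\<Union>i\<in>C. ?cball i))"
    proof (rule Vitali_covering_theorem_cballs[of ?K "\<lambda>i. (r i - l i) / 2" E "\<lambda>i. (l i + r i) / 2"])
      show "0 < (r i - l i) / 2" if "i \<in> ?K" for i
        using nondeg[of i] that by auto
      show "\<exists>i. i \<in> ?K \<and> x \<in> cball ((l i + r i) / 2) ((r i - l i) / 2) \<and> (r i - l i) / 2 < d"
        if "x \<in> E" "0 < d" for x d
      proof -
        have "E' \<subseteq> V" using B V by auto
        from cover[OF that(1) V(1) this that(2)] obtain i where
          i: "i \<in> K" "x \<in> {l i..r i}" "r i - l i < d" "{l' i..r' i} \<subseteq> V" by blast
        show ?thesis
          by (rule exI[of _ i]) (use i nondeg[OF i(1)] ball[of i] in auto)
      qed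
    qed
    note pw = pw[unfolded ball] and neg = neg[unfolded ball]
    let ?U = "\<Union>i\<in>C. {l i..r i}" and ?U' = "\<Union>i\<in>C. {l' i..r' i}"
    have U: "?U \<in> sets lebesgue" and U': "?U' \<in> sets lebesgue"
      using C by (auto intro!: sets.countable_UN')
    have "disjoint_family_on (\<lambda>i. {l i..r i}) C"
      using pw by (auto simp: disjoint_family_on_def pairwise_def disjnt_def)
    then have eU: "emeasure lebesgue ?U = (\<integral>\<^sup>+i. emeasure lebesgue {l i..r i} \<partial>count_space C)"
      using C by (intro emeasure_UN_countable) auto
    have "disjoint_family_on (\<lambda>i. {l' i..r' i}) C"
      unfolding disjoint_family_on_def
    proof (intro ballI impI)
      fix i j assume ij: "i \<in> C" "j \<in> C" "i \<noteq> j"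
      then have "disjnt {l i..r i} {l j..r j}" using pw by (auto simp: pairwise_def)
      with disj[of i j] ij C show "{l' i..r' i} \<inter> {l' j..r' j} = {}"
        by (auto simp: disjnt_def)
    qed
    then have eU': "emeasure lebesgue ?U' = (\<integral>\<^sup>+i. emeasure lebesgue {l' i..r' i} \<partial>count_space C)"
      using C by (intro emeasure_UN_countable) auto
    have N: "E - ?U \<in> null_sets lebesgue" using neg by (simp add: negligible_iff_null_sets)
    have "outer_measure_of lebesgue E \<le> outer_measure_of lebesgue (?U \<union> (E - ?U))"
      by (rule outer_measure_of_mono) auto
    also have "\<dots> = emeasure lebesgue (?U \<union> (E - ?U))"
      using U N by (intro outer_measure_of_eq sets.Un) auto
    also have "\<dots> = emeasure lebesgue ?U"
      using U N by (rule emeasure_Un_null_set)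
    finally have "ennreal q * outer_measure_of lebesgue E \<le> ennreal q * emeasure lebesgue ?U"
      by (rule mult_left_mono) simp
    also have "\<dots> = (\<integral>\<^sup>+i. ennreal q * emeasure lebesgue {l i..r i} \<partial>count_space C)"
      unfolding eU by (rule nn_integral_cmult[symmetric]) simp
    also have "\<dots> \<le> (\<integral>\<^sup>+i. emeasure lebesgue {l' i..r' i} \<partial>count_space C)"
    proof (rule nn_integral_mono)
      fix i assume "i \<in> space (count_space C)"
      then have i: "i \<in> K" using C by auto
      show "ennreal q * emeasure lebesgue {l i..r i} \<le> emeasure lebesgue {l' i..r' i}"
        using nondeg[OF i] ratio[OF i] q by (simp add: ennreal_mult[symmetric] ennreal_leI)
    qed
    also have "\<dots> = emeasure lebesgue ?U'" using eU' by simp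
    also have "\<dots> \<le> emeasure lebesgue (B \<union> (V - B))"
      using C B V U' by (intro emeasure_mono) (auto dest!: subsetD[OF C(2)])
    also have "\<dots> \<le> emeasure lebesgue B + emeasure lebesgue (V - B)"
      using B V by (intro emeasure_subadditive) auto
    also have "\<dots> \<le> emeasure lebesgue B + ennreal e"
      using V(4) by (intro add_left_mono) auto
    finally show ?thesis .
  qed
  show ?thesis
    unfolding outer_measure_of_def[of _ E']
  proof (rule INF_greatest)
    fix B assume B: "B \<in> {B \<in> sets lebesgue. E' \<subseteq> B}"
    show "ennreal q * outer_measure_of lebesgue E \<le> emeasure lebesgue B"
      by (rule ennreal_le_epsilon) (use main[of B] B in auto)
  qed
qed

text \<open>
Continuity at the points of \<open>E\<close> makes the image interval of a short interval around \<open>x\<close> fit into any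
given neighbourhood of \<open>g x\<close>, so jumps of \<open>g\<close> elsewhere do no harm.
\<close>
lemma outer_measure_image_ge:
  fixes g :: "real \<Rightarrow> real"
  assumes g: "strict_mono g" and cont: "\<And>x. x \<in> E \<Longrightarrow> isCont g x" and q: "0 \<le> q"
    and E: "\<And>x d. x \<in> E \<Longrightarrow> 0 < d \<Longrightarrow>
      \<exists>l r. l < r \<and> x \<in> {l..r} \<and> r - l < d \<and> q * (r - l) \<le> g r - g l"
  shows "ennreal q * outer_measure_of lebesgue E \<le> outer_measure_of lebesgue (g ` E)"
proof (rule vitali_outer_measure_comparison
    [of "{(l, r). l < r \<and> q * (r - l) \<le> g r - g l}" fst snd "g \<circ> fst" "g \<circ> snd"])
  fix i assume "i \<in> {(l, r). l < r \<and> q * (r - l) \<le> g r - g l}"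
  then show "fst i < snd i \<and> (g \<circ> fst) i \<le> (g \<circ> snd) i" "q * (snd i - fst i) \<le> (g \<circ> snd) i - (g \<circ> fst) i"
    using g by (auto simp: strict_mono_def less_imp_le)
next
  fix i j assume ij: "i \<in> {(l, r). l < r \<and> q * (r - l) \<le> g r - g l}"
    "j \<in> {(l, r). l < r \<and> q * (r - l) \<le> g r - g l}" and d: "disjnt {fst i..snd i} {fst j..snd j}"
  have "snd i < fst j \<or> snd j < fst i"
  proof (rule ccontr)
    assume "\<not> ?thesis"
    then have "max (fst i) (fst j) \<in> {fst i..snd i} \<inter> {fst j..snd j}" using ij by auto
    then show False using d by (auto simp: disjnt_def)
  qed
  then have "g (snd i) < g (fst j) \<or> g (snd j) < g (fst i)"
    using g by (auto simp: strict_mono_def)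
  then show "disjnt {(g \<circ> fst) i..(g \<circ> snd) i} {(g \<circ> fst) j..(g \<circ> snd) j}"
    by (auto simp: disjnt_def)
next
  fix x V and d :: real assume x: "x \<in> E" and V: "open V" "g ` E \<subseteq> V" and d: "0 < d"
  then have "g x \<in> V" by blast
  with V(1) obtain e where e: "e > 0" "ball (g x) e \<subseteq> V" by (rule openE)
  from cont[OF x, unfolded continuous_at_eps_delta, rule_format, OF e(1)]
  obtain s where s: "s > 0" "\<And>y. dist y x < s \<Longrightarrow> dist (g y) (g x) < e"
    by blast
  obtain l r where lr: "l < r" "x \<in> {l..r}" "r - l < min d s" "q * (r - l) \<le> g r - g l"
    using E[OF x, of "min d s"] d s by auto
  then have "dist (g l) (g x) < e" "dist (g r) (g x) < e"
    using s(2)[of l] s(2)[of r] by (auto simp: dist_real_def)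
  then have "{g l..g r} \<subseteq> ball (g x) e" by (auto simp: dist_real_def abs_less_iff)
  with e have "{g l..g r} \<subseteq> V" by blast
  then show "\<exists>i\<in>{(l, r). l < r \<and> q * (r - l) \<le> g r - g l}. x \<in> {fst i..snd i} \<and> snd i - fst i < d \<and>
         {(g \<circ> fst) i..(g \<circ> snd) i} \<subseteq> V"
    using lr by (intro bexI[of _ "(l, r)"]) auto
qed (rule q)

text \<open>
The mirror image of \<open>outer_measure_image_ge\<close>: now the intervals \<open>{g l..g r}\<close> are the Vitali cover, of
the set \<open>g ` E\<close>, and \<open>{l..r}\<close> is the partner.
\<close>
lemma outer_measure_image_le:
  fixes g :: "real \<Rightarrow> real"
  assumes g: "strict_mono g" and cont: "\<And>x. x \<in> E \<Longrightarrow> isCont g x" and p: "0 < p"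
    and E: "\<And>x d. x \<in> E \<Longrightarrow> 0 < d \<Longrightarrow>
      \<exists>l r. l < r \<and> x \<in> {l..r} \<and> r - l < d \<and> g r - g l \<le> p * (r - l)"
  shows "ennreal (1 / p) * outer_measure_of lebesgue (g ` E) \<le> outer_measure_of lebesgue E"
proof (rule vitali_outer_measure_comparison
    [of "{(l, r). l < r \<and> g r - g l \<le> p * (r - l)}" "g \<circ> fst" "g \<circ> snd" fst snd])
  fix i assume "i \<in> {(l, r). l < r \<and> g r - g l \<le> p * (r - l)}"
  then show "(g \<circ> fst) i < (g \<circ> snd) i \<and> fst i \<le> snd i" "1 / p * ((g \<circ> snd) i - (g \<circ> fst) i) \<le> snd i - fst i"
    using g p by (auto simp: strict_mono_def field_simps)
next
  fix i j assume ij: "i \<in> {(l, r). l < r \<and> g r - g l \<le> p * (r - l)}"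
    "j \<in> {(l, r). l < r \<and> g r - g l \<le> p * (r - l)}" and
    d: "disjnt {(g \<circ> fst) i..(g \<circ> snd) i} {(g \<circ> fst) j..(g \<circ> snd) j}"
  have m: "a \<le> b \<Longrightarrow> g a \<le> g b" for a b using g by (simp add: strict_mono_less_eq)
  show "disjnt {fst i..snd i} {fst j..snd j}"
    unfolding disjnt_def
  proof (rule ccontr)
    assume "{fst i..snd i} \<inter> {fst j..snd j} \<noteq> {}"
    then obtain z where "z \<in> {fst i..snd i} \<inter> {fst j..snd j}" by blast
    then have "g z \<in> {(g \<circ> fst) i..(g \<circ> snd) i} \<inter> {(g \<circ> fst) j..(g \<circ> snd) j}"
      using m by auto
    then show False using d by (auto simp: disjnt_def)
  qed
next
  fix x V and d :: real assume x: "x \<in> g ` E" and V: "open V" "E \<subseteq> V" and d: "0 < d"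
  then obtain y where y: "y \<in> E" "x = g y" by auto
  then have "y \<in> V" using V by blast
  with V(1) obtain e where e: "e > 0" "ball y e \<subseteq> V" by (rule openE)
  have "d / 2 > 0" using d by simp
  from cont[OF y(1), unfolded continuous_at_eps_delta, rule_format, OF this]
  obtain s where s: "s > 0" "\<And>z. dist z y < s \<Longrightarrow> dist (g z) (g y) < d / 2"
    by blast
  obtain l r where lr: "l < r" "y \<in> {l..r}" "r - l < min e s" "g r - g l \<le> p * (r - l)"
    using E[OF y(1), of "min e s"] e s by auto
  then have "dist (g l) (g y) < d / 2" "dist (g r) (g y) < d / 2"
    using s(2)[of l] s(2)[of r] by (auto simp: dist_real_def)
  then have "g r - g l < d" unfolding dist_real_def by linarith
  moreover have "{l..r} \<subseteq> ball y e" using lr by (auto simp: dist_real_def)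
  moreover have "g l \<le> x" "x \<le> g r" using lr y g by (auto simp: strict_mono_less_eq)
  ultimately show "\<exists>i\<in>{(l, r). l < r \<and> g r - g l \<le> p * (r - l)}.
      x \<in> {(g \<circ> fst) i..(g \<circ> snd) i} \<and> (g \<circ> snd) i - (g \<circ> fst) i < d \<and> {fst i..snd i} \<subseteq> V"
    using lr e by (intro bexI[of _ "(l, r)"]) auto
qed (use p in simp)

text \<open>
Where the difference quotients oscillate between below \<open>p\<close> and above \<open>q > p\<close>, the two comparison
lemmas give \<open>q |E| \<le> |g E| \<le> p |E|\<close> for the outer measures, so \<open>|E| = 0\<close>. Where the
quotients are unbounded, \<open>k |E| \<le> |g E|\<close> for every \<open>k\<close>, while \<open>|g E|\<close> is locally bounded.
\<close>
theorem strict_mono_AE_differentiable: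
  fixes g :: "real \<Rightarrow> real"
  assumes g: "strict_mono g"
  shows "negligible {x. \<not> g differentiable at x}"
proof -
  define up where "up q = {x. \<forall>d>0. \<exists>l r. l < r \<and> x \<in> {l..r} \<and> r - l < d \<and> q * (r - l) \<le> g r - g l}" for q :: real
  define lo where "lo p = {x. \<forall>d>0. \<exists>l r. l < r \<and> x \<in> {l..r} \<and> r - l < d \<and> g r - g l \<le> p * (r - l)}" for p :: real
  define S where "S n = {x. isCont g x} \<inter> {- real n..real n}" for n
  have mono_g: "x \<le> y \<Longrightarrow> g x \<le> g y" for x y using g by (simp add: strict_mono_less_eq)
  have fin: "outer_measure_of lebesgue X \<le> ennreal (2 * real n)" if "X \<subseteq> S n" for X n
  proof -
    have "X \<subseteq> {- real n..real n}" using that by (auto simp: S_def)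
    from outer_measure_of_mono[OF this, of lebesgue] show ?thesis by simp
  qed
  have oscillating: "negligible (up q \<inter> lo p \<inter> S n)" if pq: "0 < p" "p < q" for p q n
  proof (rule negligible_of_outer_measure_zero)
    let ?E = "up q \<inter> lo p \<inter> S n" and ?o = "outer_measure_of lebesgue"
    have 1: "ennreal q * ?o ?E \<le> ?o (g ` ?E)"
      by (rule outer_measure_image_ge[OF g]) (use pq in \<open>auto simp: up_def S_def\<close>)
    have "ennreal (1 / p) * ?o (g ` ?E) \<le> ?o ?E"
      by (rule outer_measure_image_le[OF g]) (use pq in \<open>auto simp: lo_def S_def\<close>)
    with mult_left_mono[OF 1, of "ennreal (1 / p)"]
    have 2: "ennreal (q / p) * ?o ?E \<le> ?o ?E"
      using pq by (simp add: mult.assoc[symmetric] ennreal_mult[symmetric])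
    have "?o ?E \<le> ennreal (2 * real n)" by (rule fin) auto
    then obtain s where s: "?o ?E = ennreal s" "s \<ge> 0"
      by (metis ennreal_cases infinity_ennreal_def neq_top_trans ennreal_neq_top)
    with 2 pq have "q / p * s \<le> s" by (simp add: ennreal_mult[symmetric])
    then have "(q / p - 1) * s \<le> 0" by (simp add: algebra_simps)
    moreover have "q / p - 1 > 0" using pq by simp
    ultimately have "s \<le> 0" using mult_pos_pos[of "q / p - 1" s] by linarith
    with s show "?o ?E = 0" by simp
  qed
  have infinite_slope: "negligible ((\<Inter>k::nat. up (real k)) \<inter> S n)" for n
  proof (rule negligible_of_outer_measure_zero)
    let ?E = "(\<Inter>k::nat. up (real k)) \<inter> S n" and ?o = "outer_measure_of lebesgue"
    have "?o ?E \<le> ennreal (2 * real n)" by (rule fin) auto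
    then obtain s where s: "?o ?E = ennreal s" "s \<ge> 0"
      by (metis ennreal_cases infinity_ennreal_def neq_top_trans ennreal_neq_top)
    have "real k * s \<le> g (real n) - g (- real n)" for k :: nat
    proof -
      have "ennreal (real k) * ?o ?E \<le> ?o (g ` ?E)"
        by (rule outer_measure_image_ge[OF g]) (auto simp: up_def S_def)
      also have "\<dots> \<le> ?o {g (- real n)..g (real n)}"
        by (rule outer_measure_of_mono) (auto simp: S_def intro!: mono_g)
      also have "\<dots> = ennreal (g (real n) - g (- real n))"
        using mono_g[of "- real n" "real n"] by simp
      finally show ?thesis
        using s mono_g[of "- real n" "real n"] by (simp add: ennreal_mult[symmetric])
    qed
    then have "\<not> 0 < s" using reals_Archimedean3 by (metis not_le)
    with s show "?o ?E = 0" by simp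
  qed
  have "countable {x. \<not> isCont g x}"
    by (rule mono_ctble_discont) (use g in \<open>simp add: strict_mono_mono\<close>)
  then have "negligible {x. \<not> isCont g x}" by (simp add: negligible_iff_null_sets null_sets_completionI countable_imp_null_set_lborel)
  moreover have "negligible (\<Union>n. \<Union>(p, q)\<in>{(p, q). 0 < p \<and> p < q} \<inter> \<rat> \<times> \<rat>. up q \<inter> lo p \<inter> S n)"
  proof -
    have "countable ({(p, q). 0 < p \<and> p < q} \<inter> \<rat> \<times> (\<rat> :: real set))"
      by (intro countable_Int2 countable_SIGMA countable_rat)
    then show ?thesis
      by (intro negligible_countable_Union) (auto intro!: negligible_countable_Union oscillating countable_image)
  qed
  moreover have "negligible (\<Union>n. (\<Inter>k::nat. up (real k)) \<inter> S n)"
    by (intro negligible_countable_Union) (auto intro: infinite_slope)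
  ultimately have "negligible ({x. \<not> isCont g x} \<union>
      (\<Union>n. \<Union>(p, q)\<in>{(p, q). 0 < p \<and> p < q} \<inter> \<rat> \<times> \<rat>. up q \<inter> lo p \<inter> S n) \<union>
      (\<Union>n. (\<Inter>k::nat. up (real k)) \<inter> S n))" (is "negligible ?N")
    by (intro negligible_Un)
  moreover have "{x. \<not> g differentiable at x} \<subseteq> ?N"
  proof (rule ccontr)
    assume "\<not> ?thesis"
    then obtain x where nd: "\<not> g differentiable at x" and x: "x \<notin> ?N" by blast
    obtain n :: nat where "\<bar>x\<bar> \<le> real n" using real_arch_simple by blast
    with x have Sn: "x \<in> S n" by (auto simp: S_def)
    define Q where "Q y = (g y - g x) / (y - x)" for y
    have Q0: "Q y \<ge> 0" for y
      using mono_g[of x y] mono_g[of y x]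
      by (cases "y \<le> x") (auto simp: Q_def zero_le_divide_iff)
    have not_up: "eventually (\<lambda>y. Q y < q) (at x)" if "x \<notin> up q" for q
    proof -
      from that obtain d where d: "d > 0" "\<And>l r. l < r \<Longrightarrow> x \<in> {l..r} \<Longrightarrow> r - l < d \<Longrightarrow> g r - g l < q * (r - l)"
        unfolding up_def mem_Collect_eq by (meson not_le)
      have "Q y < q" if "y \<noteq> x" "dist y x < d" for y
      proof (cases "x < y")
        case True
        with d(2)[of x y] that show ?thesis by (auto simp: Q_def dist_real_def field_simps)
      next
        case False
        with that have "y < x" by auto
        with d(2)[of y x] that show ?thesis by (auto simp: Q_def dist_real_def field_simps)
      qed
      with d(1) show ?thesis unfolding eventually_at by blast
    qed
    have not_lo: "eventually (\<lambda>y. Q y > p) (at x)" if "x \<notin> lo p" for p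
    proof -
      from that obtain d where d: "d > 0" "\<And>l r. l < r \<Longrightarrow> x \<in> {l..r} \<Longrightarrow> r - l < d \<Longrightarrow> g r - g l > p * (r - l)"
        unfolding lo_def mem_Collect_eq by (meson not_le)
      have "Q y > p" if "y \<noteq> x" "dist y x < d" for y
      proof (cases "x < y")
        case True
        with d(2)[of x y] that show ?thesis by (auto simp: Q_def dist_real_def field_simps)
      next
        case False
        with that have "y < x" by auto
        with d(2)[of y x] that show ?thesis by (auto simp: Q_def dist_real_def field_simps)
      qed
      with d(1) show ?thesis unfolding eventually_at by blast
    qed
    \<comment> \<open>The derivative is the upper limit of the difference quotients.\<close>
    define B where "B = {q. eventually (\<lambda>y. Q y < q) (at x)}"
    obtain k :: nat where "x \<notin> up (real k)" using x Sn by auto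
    then have "real k \<in> B" using not_up by (simp add: B_def)
    then have Bne: "B \<noteq> {}" by auto
    have "0 \<le> q" if "q \<in> B" for q
    proof -
      have "eventually (\<lambda>y. Q y < q) (at x)" using that by (simp add: B_def)
      then have "\<exists>y. Q y < q" by (intro eventually_happens'[of "at x"]) simp_all
      with Q0 show ?thesis by (meson le_less_trans less_imp_le)
    qed
    then have Bbdd: "bdd_below B" by (auto simp: bdd_below_def)
    have "(Q \<longlongrightarrow> Inf B) (at x)"
    proof (rule order_tendstoI)
      fix a assume "Inf B < a"
      then obtain q where "q \<in> B" "q < a" using cInf_lessD[OF Bne] by blast
      then show "eventually (\<lambda>y. Q y < a) (at x)"
        by (auto simp: B_def elim: eventually_mono)
    next
      fix a assume a: "a < Inf B"
      show "eventually (\<lambda>y. a < Q y) (at x)"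
      proof (cases "a < 0")
        case True
        then have "a < Q y" for y using Q0[of y] by linarith
        then show ?thesis by simp
      next
        case False
        obtain p where p: "p \<in> \<rat>" "a < p" "p < Inf B" using Rats_dense_in_real[OF a] by auto
        obtain q where q: "q \<in> \<rat>" "p < q" "q < Inf B" using Rats_dense_in_real[OF p(3)] by auto
        have "q \<notin> B" using q Bbdd cInf_lower by fastforce
        then have "x \<in> up q" using not_up by (auto simp: B_def)
        have "(p, q) \<in> {(p, q). 0 < p \<and> p < q} \<inter> \<rat> \<times> \<rat>" using p q False by auto
        then have "x \<notin> (case (p, q) of (p, q) \<Rightarrow> up q \<inter> lo p \<inter> S n)" using x by blast
        with \<open>x \<in> up q\<close> Sn have "x \<notin> lo p" by simp
        from not_lo[OF this] p show ?thesis by (auto elim: eventually_mono)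
      qed
    qed
    then have "(g has_field_derivative Inf B) (at x)"
      unfolding has_field_derivative_iff Q_def .
    with nd show False using real_differentiable_def by blast
  qed
  ultimately show ?thesis using negligible_subset by blast
qed

text \<open>
Adding the identity makes a monotone function strictly monotone without affecting differentiability.
\<close>
corollary mono_AE_differentiable:
  fixes f :: "real \<Rightarrow> real"
  assumes f: "mono f"
  shows "negligible {x. \<not> f differentiable at x}"
proof -
  have "strict_mono (\<lambda>x. f x + x)"
  proof (rule strict_monoI)
    fix x y :: real assume "x < y"
    then show "f x + x < f y + y" using monoD[OF f, of x y] by simp
  qed
  from strict_mono_AE_differentiable[OF this]
  show ?thesis
  proof (rule negligible_subset)
    have "f differentiable at x" if "(\<lambda>x. f x + x) differentiable at x" for x
      using differentiable_diff[OF that differentiable_ident] by simp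
    then show "{x. \<not> f differentiable at x} \<subseteq> {x. \<not> (\<lambda>x. f x + x) differentiable at x}"
      by blast
  qed
qed

section \<open>Absolutely continuous functions\<close>

lemma disjoint_intervals_total_length_le:
  assumes P: "finite P" "\<And>c d. (c, d) \<in> P \<Longrightarrow> c < d \<and> {c<..<d} \<subseteq> W"
    and disj: "disjoint_family_on (\<lambda>(c, d). {c<..<d :: real}) P" and W: "W \<in> lmeasurable"
  shows "(\<Sum>(c, d)\<in>P. d - c) \<le> measure lebesgue W"
proof -
  have "(\<Sum>(c, d)\<in>P. d - c) = (\<Sum>i\<in>P. measure lebesgue ((\<lambda>(c, d). {c<..<d}) i))"
    using P(2) by (intro sum.cong) (auto simp: less_imp_le)
  also have "\<dots> = measure lebesgue (\<Union>i\<in>P. (\<lambda>(c, d). {c<..<d}) i)"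
  proof (rule measure_finite_Union[symmetric])
    show "emeasure lebesgue ((\<lambda>(c, d). {c<..<d}) i) \<noteq> \<infinity>" if "i \<in> P" for i
      using P(2) that by (cases i) (auto simp: less_imp_le)
  qed (use P disj in auto)
  also have "\<dots> \<le> measure lebesgue W"
    using P W by (intro measure_mono_fmeasurable) (auto split: prod.splits)
  finally show ?thesis .
qed

lemma abs_cont_on_imp_continuous_on:
  assumes "abs_cont_on {a..b} f"
  shows "continuous_on {a..b} f"
  unfolding continuous_on_iff
proof (intro ballI allI impI)
  fix x e :: real assume x: "x \<in> {a..b}" and e: "0 < e"
  from assms e obtain \<delta> where \<delta>: "\<delta> > 0" and A: "\<And>P. finite P \<and>
        (\<forall>(c, d)\<in>P. c < d \<and> {c..d} \<subseteq> {a..b}) \<and>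
        disjoint_family_on (\<lambda>(c, d). {c<..<d}) P \<and>
        (\<Sum>(c, d)\<in>P. d - c) < \<delta> \<Longrightarrow> (\<Sum>(c, d)\<in>P. \<bar>f d - f c\<bar>) < e"
    unfolding abs_cont_on_def by blast
  have *: "\<bar>f d - f c\<bar> < e" if "c < d" "c \<in> {a..b}" "d \<in> {a..b}" "d - c < \<delta>" for c d
    using A[of "{(c, d)}"] that by (auto simp: disjoint_family_on_def)
  have "dist (f y) (f x) < e" if "y \<in> {a..b}" "dist y x < \<delta>" for y
    using *[of x y] *[of y x] that x e
    by (cases x y rule: linorder_cases) (auto simp: dist_real_def abs_minus_commute)
  with \<delta> show "\<exists>d>0. \<forall>x'\<in>{a..b}. dist x' x < d \<longrightarrow> dist (f x') (f x) < e" by blast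
qed

text \<open>
The Jordan decomposition: \<open>p\<close> is the positive variation of \<open>f\<close> from \<open>c\<close>. It increases because
more families of intervals are admissible for a larger right end, and it increases at least as fast
as \<open>f\<close> because the interval between two right ends can be added to a family.
\<close>
lemma bounded_variation_imp_mono_difference:
  fixes f :: "real \<Rightarrow> real"
  assumes bound: "\<And>P. finite P \<Longrightarrow> (\<And>s t. (s, t) \<in> P \<Longrightarrow> s < t \<and> {s..t} \<subseteq> {c..d}) \<Longrightarrow>
      disjoint_family_on (\<lambda>(s, t). {s<..<t}) P \<Longrightarrow> (\<Sum>(s, t)\<in>P. f t - f s) \<le> B"
  obtains p where "mono_on {c..d} p" "mono_on {c..d} (\<lambda>x. p x - f x)"
proof
  define adm where "adm x = {P. finite P \<and> (\<forall>(s, t)\<in>P. s < t \<and> {s..t} \<subseteq> {c..x}) \<and>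
      disjoint_family_on (\<lambda>(s, t). {s<..<t}) P}" for x
  define var where "var P = (\<Sum>(s, t)\<in>P. f t - f s)" for P
  define p where "p x = (SUP P\<in>adm x. var P)" for x
  have ne: "adm x \<noteq> {}" for x
    by (auto simp: adm_def disjoint_family_on_def intro!: exI[of _ "{}"])
  have bdd: "bdd_above (var ` adm x)" if "x \<in> {c..d}" for x
  proof (rule bdd_aboveI2)
    fix P assume "P \<in> adm x"
    then show "var P \<le> B"
      unfolding var_def adm_def using that by (intro bound) auto
  qed
  show "mono_on {c..d} p"
  proof (rule mono_onI)
    fix x y assume xy: "x \<in> {c..d}" "y \<in> {c..d}" "x \<le> y"
    have "adm x \<subseteq> adm y"
    proof
      fix P assume "P \<in> adm x"
      moreover have "{c..x} \<subseteq> {c..y}" using xy by auto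
      ultimately show "P \<in> adm y" unfolding adm_def by blast
    qed
    then show "p x \<le> p y"
      unfolding p_def using bdd[OF xy(2)] ne by (intro cSUP_subset_mono) auto
  qed
  show "mono_on {c..d} (\<lambda>x. p x - f x)"
  proof (rule mono_onI)
    fix x y assume xy: "x \<in> {c..d}" "y \<in> {c..d}" "x \<le> y"
    show "p x - f x \<le> p y - f y"
    proof (cases "x = y")
      case False
      with xy have lt: "x < y" by simp
      have "p x \<le> p y - (f y - f x)"
        unfolding p_def[of x]
      proof (rule cSUP_least[OF ne])
        fix P assume P: "P \<in> adm x"
        have fin: "finite P" and sub: "\<And>s t. (s, t) \<in> P \<Longrightarrow> s < t \<and> {s..t} \<subseteq> {c..x}"
          and dj: "disjoint_family_on (\<lambda>(s, t). {s<..<t}) P"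
          using P by (auto simp: adm_def)
        have le: "s < t \<and> c \<le> s \<and> t \<le> x" if "(s, t) \<in> P" for s t
          using sub[OF that] by auto
        have new: "(x, y) \<notin> P" using le[of x y] lt by auto
        have "insert (x, y) P \<in> adm y"
          unfolding adm_def
        proof (intro CollectI conjI)
          show "\<forall>(s, t)\<in>insert (x, y) P. s < t \<and> {s..t} \<subseteq> {c..y}"
            using le lt xy by fastforce
          have "\<forall>i\<in>P. {x<..<y} \<inter> (\<lambda>(s, t). {s<..<t}) i = {}"
            using le by fastforce
          then show "disjoint_family_on (\<lambda>(s, t). {s<..<t}) (insert (x, y) P)"
            using dj new by (simp add: disjoint_family_on_insert) blast
        qed (use fin in simp)
        then have "var (insert (x, y) P) \<le> p y"
          unfolding p_def using bdd[OF xy(2)] by (rule cSUP_upper)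
        then show "var P \<le> p y - (f y - f x)"
          using fin new by (simp add: var_def)
      qed
      then show ?thesis by simp
    qed simp
  qed
qed

lemma mono_on_AE_differentiable:
  fixes p :: "real \<Rightarrow> real"
  assumes "mono_on {c..d} p"
  shows "negligible {x\<in>{c<..<d}. \<not> p differentiable at x}"
proof (cases "c < d")
  case True
  let ?q = "\<lambda>x. p (max c (min d x))"
  have "mono ?q"
    using True by (intro monoI mono_onD[OF assms]) auto
  from mono_AE_differentiable[OF this] show ?thesis
  proof (rule negligible_subset)
    have "p differentiable at x" if x: "x \<in> {c<..<d}" and "?q differentiable at x" for x
    proof -
      from that obtain D where D: "(?q has_derivative D) (at x)" by (auto simp: differentiable_def)
      have "(p has_derivative D) (at x)"
        by (rule has_derivative_transform_within_open[OF D, of "{c<..<d}"]) (use x in auto)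
      then show ?thesis by (auto simp: differentiable_def)
    qed
    then show "{x\<in>{c<..<d}. \<not> p differentiable at x} \<subseteq> {x. \<not> ?q differentiable at x}"
      by blast
  qed
qed simp

text \<open>
On an interval shorter than the \<open>\<delta>\<close> belonging to \<open>\<epsilon> = 1\<close>, every disjoint family of subintervals has
variation at most 1. So the Jordan decomposition exists there, and countably many such intervals
with rational ends cover the open interval.
\<close>
theorem abs_cont_on_AE_differentiable:
  assumes ac: "abs_cont_on {a..b} f"
  shows "negligible {x\<in>{a<..<b}. \<not> f differentiable at x}"
proof -
  from ac obtain \<delta> where \<delta>: "\<delta> > 0" and A: "\<And>P. finite P \<and>
        (\<forall>(c, d)\<in>P. c < d \<and> {c..d} \<subseteq> {a..b}) \<and>
        disjoint_family_on (\<lambda>(c, d). {c<..<d}) P \<and>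
        (\<Sum>(c, d)\<in>P. d - c) < \<delta> \<Longrightarrow> (\<Sum>(c, d)\<in>P. \<bar>f d - f c\<bar>) < 1"
    unfolding abs_cont_on_def using zero_less_one by blast
  have short: "negligible {x\<in>{c<..<d}. \<not> f differentiable at x}"
    if cd: "a \<le> c" "c < d" "d \<le> b" "d - c < \<delta>" for c d
  proof -
    obtain p where p: "mono_on {c..d} p" "mono_on {c..d} (\<lambda>x. p x - f x)"
    proof (rule bounded_variation_imp_mono_difference[of c d f 1])
      fix P assume P: "finite P" "\<And>s t. (s, t) \<in> P \<Longrightarrow> s < t \<and> {s..t} \<subseteq> {c..d}"
        "disjoint_family_on (\<lambda>(s, t). {s<..<t :: real}) P"
      have sub: "s < t \<and> {s<..<t} \<subseteq> {c<..<d} \<and> {s..t} \<subseteq> {a..b}" if "(s, t) \<in> P" for s t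
        using P(2)[OF that] cd by auto
      have "(\<Sum>(s, t)\<in>P. t - s) \<le> measure lebesgue {c<..<d}"
        using P sub by (intro disjoint_intervals_total_length_le) auto
      also have "\<dots> < \<delta>" using cd by simp
      finally have "(\<Sum>(s, t)\<in>P. \<bar>f t - f s\<bar>) < 1"
        using P(1,3) sub by (intro A) auto
      moreover have "(\<Sum>(s, t)\<in>P. f t - f s) \<le> (\<Sum>(s, t)\<in>P. \<bar>f t - f s\<bar>)"
        by (rule sum_mono) auto
      ultimately show "(\<Sum>(s, t)\<in>P. f t - f s) \<le> 1" by linarith
    qed
    have "negligible ({x\<in>{c<..<d}. \<not> p differentiable at x} \<union>
        {x\<in>{c<..<d}. \<not> (\<lambda>x. p x - f x) differentiable at x})"
      by (intro negligible_Un mono_on_AE_differentiable p)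
    then show ?thesis
    proof (rule negligible_subset)
      have "f differentiable at x" if "p differentiable at x" "(\<lambda>x. p x - f x) differentiable at x" for x
        using differentiable_diff[OF that] by simp
      then show "{x\<in>{c<..<d}. \<not> f differentiable at x} \<subseteq> {x\<in>{c<..<d}. \<not> p differentiable at x} \<union>
        {x\<in>{c<..<d}. \<not> (\<lambda>x. p x - f x) differentiable at x}"
        by blast
    qed
  qed
  let ?I = "{(c, d). a \<le> c \<and> c < d \<and> d \<le> b \<and> d - c < \<delta>} \<inter> \<rat> \<times> \<rat>"
  have "countable ?I" by (intro countable_Int2 countable_SIGMA countable_rat)
  then have "negligible (\<Union>(c, d)\<in>?I. {x\<in>{c<..<d}. \<not> f differentiable at x})"
  proof (intro negligible_countable_Union countable_image)
    fix S assume "S \<in> (\<lambda>(c, d). {x\<in>{c<..<d}. \<not> f differentiable at x}) ` ?I"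
    then obtain c d where "(c, d) \<in> ?I" "S = {x\<in>{c<..<d}. \<not> f differentiable at x}" by blast
    then show "negligible S" using short[of c d] by simp
  qed
  then show ?thesis
  proof (rule negligible_subset)
    show "{x\<in>{a<..<b}. \<not> f differentiable at x} \<subseteq> (\<Union>(c, d)\<in>?I. {x\<in>{c<..<d}. \<not> f differentiable at x})"
    proof
      fix x assume x: "x \<in> {x\<in>{a<..<b}. \<not> f differentiable at x}"
      have "max a (x - \<delta> / 2) < x" using x \<delta> by auto
      then obtain c where c: "c \<in> \<rat>" "max a (x - \<delta> / 2) < c" "c < x"
        using Rats_dense_in_real by blast
      have "x < min b (x + \<delta> / 2)" using x \<delta> by auto
      then obtain d where d: "d \<in> \<rat>" "x < d" "d < min b (x + \<delta> / 2)"
        using Rats_dense_in_real by blast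
      have "(c, d) \<in> ?I" using c d by auto
      moreover have "x \<in> {x\<in>{c<..<d}. \<not> f differentiable at x}" using x c d by auto
      ultimately show "x \<in> (\<Union>(c, d)\<in>?I. {x\<in>{c<..<d}. \<not> f differentiable at x})" by blast
    qed
  qed
qed

text \<open>
The dyadic covering lemma on the line, with intervals recorded as pairs of end points to match the
form in which absolute continuity is stated.
\<close>
lemma nonoverlapping_interval_cover:
  fixes a b :: real
  assumes N: "N \<subseteq> {a<..<b}" and G: "\<And>x. x \<in> N \<Longrightarrow> open (G x) \<and> x \<in> G x"
  obtains C where "countable C" "\<And>c d. (c, d) \<in> C \<Longrightarrow> c < d \<and> {c..d} \<subseteq> {a..b}"
    "\<And>c d. (c, d) \<in> C \<Longrightarrow> \<exists>x\<in>N \<inter> {c..d}. {c..d} \<subseteq> G x"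
    "disjoint_family_on (\<lambda>(c, d). {c<..<d}) C" "N \<subseteq> (\<Union>(c, d)\<in>C. {c..d})"
proof (cases "a < b")
  case True
  define g where "g x = (if x \<in> N then G x else UNIV)" for x
  have "gauge g" using G by (auto simp: gauge_def g_def)
  moreover have "N \<subseteq> cbox a b" using N by auto
  moreover have "box a b \<noteq> {}" using True by simp
  ultimately obtain \<D> where D: "countable \<D>" "\<Union>\<D> \<subseteq> cbox a b"
    "\<And>K. K \<in> \<D> \<Longrightarrow> interior K \<noteq> {} \<and> (\<exists>c d. K = cbox c d)"
    "pairwise (\<lambda>A B. interior A \<inter> interior B = {}) \<D>"
    "\<And>K. K \<in> \<D> \<Longrightarrow> \<exists>x \<in> N \<inter> K. K \<subseteq> g x" "N \<subseteq> \<Union>\<D>"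
    using covering_lemma[of N a b g] by (metis (no_types, lifting))
  define C where "C = {(c, d). c < d \<and> {c..d} \<in> \<D>}"
  have K: "\<exists>c d. K = {c..d} \<and> c < d" if "K \<in> \<D>" for K
    using D(3)[OF that] by (auto simp: cbox_interval)
  show ?thesis
  proof
    have "inj_on (\<lambda>(c, d). {c..d}) C"
      by (auto simp: inj_on_def C_def Icc_eq_Icc)
    moreover have "countable ((\<lambda>(c, d). {c..d}) ` C)"
      by (rule countable_subset[OF _ D(1)]) (auto simp: C_def)
    ultimately show "countable C" by (metis countable_image_inj_on)
    show "c < d \<and> {c..d} \<subseteq> {a..b}" if "(c, d) \<in> C" for c d
      using that D(2) by (auto simp: C_def cbox_interval simp del: atLeastatMost_subset_iff)
    show "\<exists>x\<in>N \<inter> {c..d}. {c..d} \<subseteq> G x" if "(c, d) \<in> C" for c d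
      using D(5)[of "{c..d}"] that by (auto simp: C_def g_def)
    show "disjoint_family_on (\<lambda>(c, d). {c<..<d}) C"
      unfolding disjoint_family_on_def
    proof (intro ballI impI)
      fix i j assume ij: "i \<in> C" "j \<in> C" "i \<noteq> j"
      obtain c d c' d' where eq: "i = (c, d)" "j = (c', d')" by (cases i, cases j)
      have "{c..d} \<in> \<D>" "{c'..d'} \<in> \<D>" using ij by (auto simp: eq C_def)
      have "{c..d} \<noteq> {c'..d'}" using ij by (auto simp: eq C_def Icc_eq_Icc)
      then have "interior {c..d} \<inter> interior {c'..d'} = {}"
        using D(4) \<open>{c..d} \<in> \<D>\<close> \<open>{c'..d'} \<in> \<D>\<close> unfolding pairwise_def by blast
      then show "(\<lambda>(c, d). {c<..<d}) i \<inter> (\<lambda>(c, d). {c<..<d}) j = {}"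
        by (simp add: eq)
    qed
    show "N \<subseteq> (\<Union>(c, d)\<in>C. {c..d})"
    proof
      fix x assume "x \<in> N"
      then obtain K where "K \<in> \<D>" "x \<in> K" using D(6) by blast
      moreover from K[OF this(1)] obtain c d where "K = {c..d}" "c < d" by blast
      ultimately have "(c, d) \<in> C" "x \<in> {c..d}" by (auto simp: C_def)
      then show "x \<in> (\<Union>(c, d)\<in>C. {c..d})" by blast
    qed
  qed
next
  case False
  with N show ?thesis by (intro that[of "{}"]) (auto simp: disjoint_family_on_def)
qed

lemma continuous_image_interval_oscillation:
  fixes f :: "real \<Rightarrow> real"
  assumes "continuous_on {c..d} f" "c < d"
  shows "\<exists>s t. s < t \<and> {s..t} \<subseteq> {c..d} \<and> measure lebesgue (f ` {c..d}) \<le> \<bar>f t - f s\<bar>"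
proof -
  obtain x where x: "x \<in> {c..d}" "\<And>y. y \<in> {c..d} \<Longrightarrow> f x \<le> f y"
    using continuous_attains_inf[of "{c..d}" f] assms by auto
  obtain z where z: "z \<in> {c..d}" "\<And>y. y \<in> {c..d} \<Longrightarrow> f y \<le> f z"
    using continuous_attains_sup[of "{c..d}" f] assms by auto
  have "measure lebesgue (f ` {c..d}) \<le> measure lebesgue {f x..f z}"
    using x z assms by (intro measure_mono_fmeasurable) (auto intro!: lmeasurable_compact[THEN fmeasurableD] compact_continuous_image)
  then have m: "measure lebesgue (f ` {c..d}) \<le> f z - f x" using x z by simp
  consider "x < z" | "z < x" | "x = z" by linarith
  then show ?thesis
  proof cases
    case 1
    then show ?thesis using m x z by (intro exI[of _ x] exI[of _ z]) auto
  next
    case 2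
    then show ?thesis using m x z by (intro exI[of _ z] exI[of _ x]) auto
  next
    case 3
    then show ?thesis using m assms by (intro exI[of _ c] exI[of _ d]) auto
  qed
qed

text \<open>
Cover \<open>N\<close> by non-overlapping intervals inside an open set of measure below \<open>\<delta>\<close>. The image of each of
them is no longer than the increment of \<open>f\<close> between a minimum and a maximum point, and these
subintervals again form a disjoint family of total length below \<open>\<delta>\<close>.
\<close>
lemma abs_cont_on_Luzin:
  assumes ac: "abs_cont_on {a..b} f" and N: "negligible N" "N \<subseteq> {a<..<b}"
  shows "negligible (f ` N)"
  unfolding negligible_outer_le
proof (intro allI impI)
  fix e :: real assume "e > 0"
  with ac obtain \<delta> where \<delta>: "\<delta> > 0" and A: "\<And>P. finite P \<and>
        (\<forall>(c, d)\<in>P. c < d \<and> {c..d} \<subseteq> {a..b}) \<and>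
        disjoint_family_on (\<lambda>(c, d). {c<..<d}) P \<and>
        (\<Sum>(c, d)\<in>P. d - c) < \<delta> \<Longrightarrow> (\<Sum>(c, d)\<in>P. \<bar>f d - f c\<bar>) < e"
    unfolding abs_cont_on_def by blast
  have cont: "continuous_on {a..b} f" by (rule abs_cont_on_imp_continuous_on[OF ac])
  have "N \<in> null_sets lebesgue" using N by (simp add: negligible_iff_null_sets)
  then have "N \<in> sets lebesgue" by auto
  then obtain U where U: "open U" "N \<subseteq> U" "U - N \<in> lmeasurable" "emeasure lebesgue (U - N) < ennreal \<delta>"
    using sets_lebesgue_outer_open[OF _ \<delta>] by blast
  have mU: "U \<in> lmeasurable" "measure lebesgue U < \<delta>"
  proof -
    have "emeasure lebesgue U = emeasure lebesgue ((U - N) \<union> N)" using U by (simp add: Un_absorb2)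
    also have "\<dots> = emeasure lebesgue (U - N)"
      using U(3) \<open>N \<in> null_sets lebesgue\<close> by (intro emeasure_Un_null_set) auto
    finally have *: "emeasure lebesgue U < ennreal \<delta>" using U by simp
    then show **: "U \<in> lmeasurable"
      using U by (intro fmeasurableI) (auto simp: less_top[symmetric] top_unique)
    show "measure lebesgue U < \<delta>"
      using * emeasure_eq_measure2[OF **] by (simp add: ennreal_less_iff)
  qed
  obtain C where C: "countable C" "\<And>c d. (c, d) \<in> C \<Longrightarrow> c < d \<and> {c..d} \<subseteq> {a..b}"
    "\<And>c d. (c, d) \<in> C \<Longrightarrow> \<exists>x\<in>N \<inter> {c..d}. {c..d} \<subseteq> U"
    "disjoint_family_on (\<lambda>(c, d). {c<..<d}) C" "N \<subseteq> (\<Union>(c, d)\<in>C. {c..d})"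
    using nonoverlapping_interval_cover[OF N(2), of "\<lambda>_. U"] U by blast
  have "\<exists>s t. s < t \<and> {s..t} \<subseteq> {fst i..snd i} \<and> measure lebesgue (f ` {fst i..snd i}) \<le> \<bar>f t - f s\<bar>"
    if "i \<in> C" for i
    using C(2)[of "fst i" "snd i"] that
    by (intro continuous_image_interval_oscillation continuous_on_subset[OF cont]) auto
  then obtain s t where st: "\<And>i. i \<in> C \<Longrightarrow> s i < t i \<and> {s i..t i} \<subseteq> {fst i..snd i} \<and>
      measure lebesgue (f ` {fst i..snd i}) \<le> \<bar>f (t i) - f (s i)\<bar>"
    by metis
  let ?T = "\<Union>((\<lambda>i. f ` {fst i..snd i}) ` C)"
  have meas: "f ` {fst i..snd i} \<in> lmeasurable" if "i \<in> C" for i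
    using C(2)[of "fst i" "snd i"] that
    by (intro lmeasurable_compact compact_continuous_image continuous_on_subset[OF cont]) auto
  have bound: "measure lebesgue (\<Union>\<E>) \<le> e" if "\<E> \<subseteq> (\<lambda>i. f ` {fst i..snd i}) ` C" "finite \<E>" for \<E>
  proof -
    from finite_subset_image[OF that(2) that(1)]
    obtain I where I: "I \<subseteq> C" "finite I" "\<E> = (\<lambda>i. f ` {fst i..snd i}) ` I"
      by blast
    let ?P = "(\<lambda>i. (s i, t i)) ` I"
    have dj: "{s i<..<t i} \<inter> {s j<..<t j} = {}" if "i \<in> I" "j \<in> I" "i \<noteq> j" for i j
    proof -
      have "{fst i<..<snd i} \<inter> {fst j<..<snd j} = {}"
        using C(4) that I(1) unfolding disjoint_family_on_def split_beta by blast
      moreover have "{s i<..<t i} \<subseteq> {fst i<..<snd i}" "{s j<..<t j} \<subseteq> {fst j<..<snd j}"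
        using st[of i] st[of j] that I(1) by auto
      ultimately show ?thesis by blast
    qed
    have inj: "inj_on (\<lambda>i. (s i, t i)) I"
    proof (rule inj_onI, rule ccontr)
      fix i j assume "i \<in> I" "j \<in> I" "(s i, t i) = (s j, t j)" "i \<noteq> j"
      with dj[of i j] have "{s i<..<t i} = {}" by auto
      with st[of i] \<open>i \<in> I\<close> I(1) show False by auto
    qed
    have djP: "disjoint_family_on (\<lambda>(c, d). {c<..<d}) ?P"
      using dj by (fastforce simp: disjoint_family_on_def)
    have sub: "c < d \<and> {c<..<d} \<subseteq> U \<and> {c..d} \<subseteq> {a..b}" if "(c, d) \<in> ?P" for c d
    proof -
      from that obtain i where i: "i \<in> C" "c = s i" "d = t i" using I by auto
      have "{fst i..snd i} \<subseteq> U" "{fst i..snd i} \<subseteq> {a..b}"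
        using C(2,3)[of "fst i" "snd i"] i(1) by auto
      moreover have "{s i<..<t i} \<subseteq> {s i..t i}" by auto
      ultimately show ?thesis using st[OF i(1)] i by blast
    qed
    have "(\<Sum>(c, d)\<in>?P. d - c) \<le> measure lebesgue U"
      using I sub djP mU by (intro disjoint_intervals_total_length_le) auto
    then have "(\<Sum>(c, d)\<in>?P. d - c) < \<delta>" using mU by simp
    then have "(\<Sum>(c, d)\<in>?P. \<bar>f d - f c\<bar>) < e"
      using I sub djP by (intro A) auto
    then have le: "(\<Sum>i\<in>I. \<bar>f (t i) - f (s i)\<bar>) < e"
      by (simp add: sum.reindex[OF inj])
    have "measure lebesgue (\<Union>\<E>) \<le> (\<Sum>i\<in>I. measure lebesgue (f ` {fst i..snd i}))"
      unfolding I(3) using I meas by (intro measure_UNION_le) auto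
    also have "\<dots> \<le> (\<Sum>i\<in>I. \<bar>f (t i) - f (s i)\<bar>)"
      using st I by (intro sum_mono) auto
    finally show ?thesis using le by simp
  qed
  show "\<exists>T. f ` N \<subseteq> T \<and> T \<in> lmeasurable \<and> measure lebesgue T \<le> e"
  proof (intro exI[of _ ?T] conjI)
    show "f ` N \<subseteq> ?T"
    proof
      fix v assume "v \<in> f ` N"
      then obtain x where x: "x \<in> N" "v = f x" by blast
      with C(5) obtain i where "i \<in> C" "x \<in> {fst i..snd i}" by (auto simp: split_beta)
      with x show "v \<in> ?T" by blast
    qed
    show "?T \<in> lmeasurable"
      by (rule fmeasurable_Union_bound[OF _ _ bound]) (use C(1) meas in auto)
    show "measure lebesgue ?T \<le> e"
      by (rule measure_Union_bound[OF _ _ bound]) (use C(1) meas in auto)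
  qed
qed

text \<open>
The one-dimensional Sard theorem: near a critical point \<open>x\<close> the
image of an interval of length \<open>l\<close> containing \<open>x\<close> lies within \<open>\<epsilon> l\<close> of \<open>f x\<close>, and
non-overlapping intervals have total length at most \<open>b - a\<close>.
\<close>
lemma negligible_critical_values:
  fixes f :: "real \<Rightarrow> real"
  assumes C: "C \<subseteq> {a<..<b}" and f: "\<And>x. x \<in> C \<Longrightarrow> (f has_real_derivative 0) (at x)"
  shows "negligible (f ` C)"
  unfolding negligible_outer_le
proof (intro allI impI)
  fix e :: real assume e: "e > 0"
  show "\<exists>T. f ` C \<subseteq> T \<and> T \<in> lmeasurable \<and> measure lebesgue T \<le> e"
  proof (cases "a < b")
    case False
    with C e show ?thesis by (intro exI[of _ "{}"]) auto
  next
    case True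
    define \<epsilon> where "\<epsilon> = e / (b - a) / 2"
    have \<epsilon>: "\<epsilon> > 0" using e True by (simp add: \<epsilon>_def)
    have "\<exists>r>0. \<forall>y. \<bar>y - x\<bar> < r \<longrightarrow> \<bar>f y - f x\<bar> \<le> \<epsilon> * \<bar>y - x\<bar>" if "x \<in> C" for x
      using f[OF that] \<epsilon> unfolding has_field_derivative_def has_derivative_at_alt
      by (auto simp: real_norm_def)
    then obtain r where r: "\<And>x. x \<in> C \<Longrightarrow> r x > 0"
      "\<And>x y. x \<in> C \<Longrightarrow> \<bar>y - x\<bar> < r x \<Longrightarrow> \<bar>f y - f x\<bar> \<le> \<epsilon> * \<bar>y - x\<bar>"
      by metis
    obtain K where K: "countable K" "\<And>c d. (c, d) \<in> K \<Longrightarrow> c < d \<and> {c..d} \<subseteq> {a..b}"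
      "\<And>c d. (c, d) \<in> K \<Longrightarrow> \<exists>x\<in>C \<inter> {c..d}. {c..d} \<subseteq> ball x (r x)"
      "disjoint_family_on (\<lambda>(c, d). {c<..<d}) K" "C \<subseteq> (\<Union>(c, d)\<in>K. {c..d})"
      using nonoverlapping_interval_cover[OF C, of "\<lambda>x. ball x (r x)"] r(1) by (metis centre_in_ball open_ball)
    have "\<exists>x. x \<in> C \<inter> {fst i..snd i} \<and> {fst i..snd i} \<subseteq> ball x (r x)" if "i \<in> K" for i
      using K(3)[of "fst i" "snd i"] that by auto
    then obtain z where z: "\<And>i. i \<in> K \<Longrightarrow> z i \<in> C \<inter> {fst i..snd i} \<and> {fst i..snd i} \<subseteq> ball (z i) (r (z i))"
      by metis
    define L where "L i = \<epsilon> * (snd i - fst i)" for i :: "real \<times> real"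
    define B where "B i = {f (z i) - L i..f (z i) + L i}" for i
    have L: "0 \<le> L i" if "i \<in> K" for i
      using K(2)[of "fst i" "snd i"] that \<epsilon> by (auto simp: L_def)
    have bound: "measure lebesgue (\<Union>\<E>) \<le> e" if "\<E> \<subseteq> B ` K" "finite \<E>" for \<E>
    proof -
      from finite_subset_image[OF that(2) that(1)]
      obtain I where I: "I \<subseteq> K" "finite I" "\<E> = B ` I"
        by blast
      have "(\<Sum>(c, d)\<in>I. d - c) \<le> measure lebesgue {a..b}"
        using I K(2) disjoint_family_on_mono[OF I(1) K(4)]
        by (intro disjoint_intervals_total_length_le) (auto, fastforce+)
      then have len: "(\<Sum>i\<in>I. snd i - fst i) \<le> b - a"
        using True by (simp add: split_beta)
      have "measure lebesgue (\<Union>\<E>) \<le> (\<Sum>i\<in>I. measure lebesgue (B i))"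
        unfolding I(3) using I by (intro measure_UNION_le) (auto simp: B_def)
      also have "\<dots> = (\<Sum>i\<in>I. 2 * \<epsilon> * (snd i - fst i))"
        using L I by (intro sum.cong) (auto simp: B_def L_def)
      also have "\<dots> \<le> 2 * \<epsilon> * (b - a)"
        using len \<epsilon> by (simp add: sum_distrib_left[symmetric])
      also have "\<dots> = e"
        using True nonzero_mult_div_cancel_right[of "b - a" e]
        unfolding \<epsilon>_def by (simp only: times_divide_eq_right times_divide_eq_left) simp
      finally show ?thesis .
    qed
    show ?thesis
    proof (intro exI[of _ "\<Union>(B ` K)"] conjI)
      show "f ` C \<subseteq> \<Union>(B ` K)"
      proof
        fix v assume "v \<in> f ` C"
        then obtain x where x: "x \<in> C" "v = f x" by auto
        with K(5) obtain i where i: "i \<in> K" "x \<in> {fst i..snd i}" by (auto simp: split_beta)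
        from z[OF i(1)] i(2) have zi: "z i \<in> C" "z i \<in> {fst i..snd i}" "\<bar>x - z i\<bar> < r (z i)"
          by (auto simp: dist_real_def abs_minus_commute)
        have "\<bar>f x - f (z i)\<bar> \<le> \<epsilon> * \<bar>x - z i\<bar>" by (rule r(2)[OF zi(1,3)])
        also have "\<dots> \<le> L i" using i(2) zi(2) \<epsilon> by (auto simp: L_def)
        finally have "v \<in> B i" by (auto simp: x B_def)
        with i show "v \<in> \<Union>(B ` K)" by blast
      qed
      show "\<Union>(B ` K) \<in> lmeasurable"
        by (rule fmeasurable_Union_bound[OF _ _ bound]) (use K(1) in \<open>auto simp: B_def\<close>)
      show "measure lebesgue (\<Union>(B ` K)) \<le> e"
        by (rule measure_Union_bound[OF _ _ bound]) (use K(1) in \<open>auto simp: B_def\<close>)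
    qed
  qed
qed

section \<open>Crossings of a level and the weight\<close>

lemma superlevel_lmeasurable [intro]:
  assumes "continuous_on UNIV g"
  shows "superlevel g t \<in> lmeasurable"
proof -
  have "{x. t < g x} \<in> sets lebesgue"
    using assms by (auto intro!: lebesgue_openin[of UNIV] simp: open_Collect_less)
  then have "{-1..1} \<inter> {x. t < g x} \<in> lmeasurable" by (intro fmeasurable_Int_fmeasurable) auto
  moreover have "superlevel g t = {-1..1} \<inter> {x. t < g x}" by (auto simp: superlevel_def)
  ultimately show ?thesis by simp
qed

lemma no_zero_imp_same_sign:
  fixes g :: "real \<Rightarrow> real"
  assumes "continuous_on UNIV g" and nz: "\<And>x. x \<in> closed_segment p q \<Longrightarrow> g x \<noteq> 0"
  shows "0 < g p \<longleftrightarrow> 0 < g q"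
proof -
  have "connected (g ` closed_segment p q)"
    by (intro connected_continuous_image continuous_on_subset[OF assms(1)]) auto
  moreover have "g p \<in> g ` closed_segment p q" "g q \<in> g ` closed_segment p q" by auto
  moreover have "0 \<notin> g ` closed_segment p q" using nz by auto
  ultimately show ?thesis
    using connectedD_interval[of "g ` closed_segment p q" "g p" "g q" 0]
      connectedD_interval[of "g ` closed_segment p q" "g q" "g p" 0] by linarith
qed

text \<open>
Two applications of the weight condition: first to the last two points, then to \<open>z\<close> and the resulting
point \<open>1 - x + w\<close>, whereby the two occurrences of 1 cancel.
\<close>
lemma three_point_weight:
  fixes b :: "real \<Rightarrow> real"
  assumes b: "\<And>s t. -1 \<le> s \<Longrightarrow> s \<le> t \<Longrightarrow> t \<le> 1 \<Longrightarrow> b s + b t \<ge> b (1 - t + s)"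
    and "-1 \<le> z" "z \<le> w" "w \<le> x" "x \<le> 1"
  shows "b (x - w + z) \<le> b z + b w + b x"
proof -
  have "b (1 - x + w) \<le> b w + b x" by (rule b) (use assms in auto)
  moreover have "b (1 - (1 - x + w) + z) \<le> b z + b (1 - x + w)" by (rule b) (use assms in auto)
  ultimately show ?thesis by (simp add: algebra_simps)
qed

text \<open>
The invariant of a scan from left to right, by induction on the number of zeros of \<open>g\<close> passed so far.
Let \<open>m y\<close> be the length of the part of \<open>{-1..y}\<close> on which \<open>g\<close> is positive. Inside a positive stretch
the combined point \<open>y - m y\<close> is constant, and the weights passed so far dominate its weight. Inside
a negative stretch \<open>m y\<close> is constant; there the scan keeps a pair of points at distance \<open>m y\<close>
rather than merging them into \<open>1 - m y\<close>, because the next upward crossing \<open>x\<close> has to be combined with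
the pair by \<open>three_point_weight\<close> and the weight condition yields no bound at \<open>x - m y\<close> from the points
\<open>x\<close> and \<open>1 - m y\<close>.
\<close>
lemma crossing_weights_partial:
  fixes g b :: "real \<Rightarrow> real"
  assumes cont: "continuous_on UNIV g" and start: "g (-1) < 0" and Z: "Z = {x\<in>{-1..1}. g x = 0}"
    and fin: "finite Z"
    and cross: "\<And>z. z \<in> Z \<Longrightarrow> \<exists>e>0. \<forall>y y'. z - e < y' \<and> y' < z \<and> z < y \<and> y < z + e \<longrightarrow>
      g y' \<noteq> 0 \<and> g y \<noteq> 0 \<and> (0 < g y \<longleftrightarrow> g y' < 0)"
    and b: "\<And>s t. -1 \<le> s \<Longrightarrow> s \<le> t \<Longrightarrow> t \<le> 1 \<Longrightarrow> b s + b t \<ge> b (1 - t + s)"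
  defines "m \<equiv> \<lambda>y. measure lebesgue {x\<in>{-1..y}. 0 < g x}" and "S \<equiv> \<lambda>y. sum b {z\<in>Z. z < y}"
  assumes y: "y \<in> {-1..1}" "g y \<noteq> 0"
  shows "if 0 < g y then -1 \<le> y - m y \<and> b (y - m y) \<le> S y
    else {z\<in>Z. z < y} = {} \<and> m y = 0 \<or>
      (\<exists>z w. -1 \<le> z \<and> z \<le> w \<and> w \<le> y \<and> m y = w - z \<and> b z + b w \<le> S y)"
  using y
proof (induction "card {z\<in>Z. z < y}" arbitrary: y rule: less_induct)
  case less
  have meas: "{x\<in>{p..q}. 0 < g x} \<in> lmeasurable" "{x\<in>{p<..q}. 0 < g x} \<in> lmeasurable" for p q
  proof -
    have "{x. 0 < g x} \<in> sets lebesgue"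
      using cont by (auto intro!: lebesgue_openin[of UNIV] simp: open_Collect_less)
    then have "{p..q} \<inter> {x. 0 < g x} \<in> lmeasurable" "{p<..q} \<inter> {x. 0 < g x} \<in> lmeasurable"
      by (auto intro!: fmeasurableI2[of "{p..q}"])
    moreover have "{x\<in>{p..q}. 0 < g x} = {p..q} \<inter> {x. 0 < g x}"
      "{x\<in>{p<..q}. 0 < g x} = {p<..q} \<inter> {x. 0 < g x}" by auto
    ultimately show "{x\<in>{p..q}. 0 < g x} \<in> lmeasurable" "{x\<in>{p<..q}. 0 < g x} \<in> lmeasurable" by simp_all
  qed
  have finy: "finite {z\<in>Z. z < y}" using fin by simp
  show ?case
  proof (cases "{z\<in>Z. z < y} = {}")
    case True
    have "\<not> 0 < g x" if "x \<in> {-1..y}" for x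
    proof -
      have "(0 < g (-1)) = (0 < g x)"
      proof (rule no_zero_imp_same_sign[OF cont])
        fix v assume "v \<in> closed_segment (-1) x"
        then have v: "v \<in> {-1..1}" "v \<le> y" using that less.prems by (auto simp: closed_segment_eq_real_ivl split: if_splits)
        then show "g v \<noteq> 0" using True less.prems unfolding Z by (cases "v = y") auto
      qed
      with start show ?thesis by simp
    qed
    then have "{x\<in>{-1..y}. 0 < g x} = {}" by auto
    moreover have "\<not> 0 < g y" using \<open>\<And>x. x \<in> {-1..y} \<Longrightarrow> \<not> 0 < g x\<close> less.prems by auto
    ultimately show ?thesis using True by (simp only: m_def) simp
  next
    case False
    define z where "z = Max {z\<in>Z. z < y}"
    have z: "z \<in> Z" "z < y" and zmax: "\<And>v. v \<in> Z \<Longrightarrow> v < y \<Longrightarrow> v \<le> z"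
      using Max_in[OF finy False] Max_ge[OF finy] by (auto simp: z_def)
    have zI: "-1 < z" "z < 1" using z start less.prems unfolding Z by (auto simp: less_le)
    obtain e where e: "e > 0" "\<And>v v'. z - e < v' \<Longrightarrow> v' < z \<Longrightarrow> z < v \<Longrightarrow> v < z + e \<Longrightarrow>
      g v' \<noteq> 0 \<and> g v \<noteq> 0 \<and> (0 < g v \<longleftrightarrow> g v' < 0)"
      using cross[OF z(1)] by blast
    define y' where "y' = max (z - e / 2) ((z - 1) / 2)"
    have y': "z - e < y'" "y' < z" "-1 < y'" using e zI by (auto simp: y'_def less_max_iff_disj)
    define v0 where "v0 = min (z + e / 2) y"
    \<comment> \<open>Sign changes are known only close to \<open>z\<close>; \<open>v0\<close> transfers the sign at \<open>y\<close> to a point there.\<close>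
    have v0: "z < v0" "v0 < z + e" "v0 \<le> y" using e z by (auto simp: v0_def)
    have nzr: "g x \<noteq> 0" if "z < x" "x \<le> y" for x
    proof
      assume "g x = 0"
      then have "x \<in> Z" "x < y" using that zI less.prems unfolding Z by (auto simp: less_le)
      with zmax that show False by force
    qed
    have right: "(0 < g x) = (0 < g y)" if "z < x" "x \<le> y" for x
      by (rule no_zero_imp_same_sign[OF cont]) (use that nzr in \<open>auto simp: closed_segment_eq_real_ivl split: if_splits\<close>)
    have left: "(0 < g x) = (\<not> 0 < g y)" "g x \<noteq> 0" if "y' \<le> x" "x < z" for x
    proof -
      have "g x \<noteq> 0 \<and> g v0 \<noteq> 0 \<and> (0 < g v0 \<longleftrightarrow> g x < 0)" using e(2)[of x v0] that y' v0 by auto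
      then show "(0 < g x) = (\<not> 0 < g y)" "g x \<noteq> 0" using right[of v0] v0 by auto
    qed
    have Zy: "{v\<in>Z. v < y} = insert z {v\<in>Z. v < y'}"
    proof -
      have "v < y'" if "v \<in> Z" "v < y" "v \<noteq> z" for v
      proof (rule ccontr)
        assume "\<not> v < y'"
        with zmax[of v] that have "g v \<noteq> 0" by (intro left) auto
        with that show False unfolding Z by simp
      qed
      then show ?thesis using z y' by auto
    qed
    have new: "z \<notin> {v\<in>Z. v < y'}" using y' by auto
    have "card {v\<in>Z. v < y'} < card {v\<in>Z. v < y}"
      unfolding Zy using new fin by simp
    moreover have "y' \<in> {-1..1}" "g y' \<noteq> 0" using y' zI left[of y'] by auto
    ultimately have IH: "if 0 < g y' then -1 \<le> y' - m y' \<and> b (y' - m y') \<le> S y'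
      else {z\<in>Z. z < y'} = {} \<and> m y' = 0 \<or>
        (\<exists>z w. -1 \<le> z \<and> z \<le> w \<and> w \<le> y' \<and> m y' = w - z \<and> b z + b w \<le> S y')"
      by (rule less.hyps)
    have Sy: "S y = S y' + b z"
      unfolding S_def Zy using new fin by simp
    have split: "{x\<in>{-1..y}. 0 < g x} = {x\<in>{-1..y'}. 0 < g x} \<union> {x\<in>{y'<..y}. 0 < g x}"
      using y' z by auto
    have my: "m y = m y' + measure lebesgue {x\<in>{y'<..y}. 0 < g x}"
    proof -
      have "{x\<in>{-1..y'}. 0 < g x} \<inter> {x\<in>{y'<..y}. 0 < g x} = {}" by auto
      then show ?thesis
        unfolding m_def split measure_Un3[OF meas(1)[of "-1" y'] meas(2)[of y' y]]
        by (simp only: measure_empty diff_zero)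
    qed
    show ?thesis
    proof (cases "0 < g y")
      case True
      have "{x\<in>{y'<..y}. 0 < g x} = {z<..y}"
      proof -
        have "z < x" if "y' < x" "0 < g x" "x \<le> y" for x
          using left[of x] that True z unfolding Z by (cases x z rule: linorder_cases) auto
        then show ?thesis using right True y' by auto
      qed
      then have my: "m y = m y' + (y - z)" using my z by simp
      have down: "\<not> 0 < g y'" using left[of y'] y' True by simp
      show ?thesis
      proof (cases "{z\<in>Z. z < y'} = {} \<and> m y' = 0")
        case True
        then have "S y' = 0" unfolding S_def by (metis (no_types, lifting) sum.empty)
        with True \<open>0 < g y\<close> my Sy zI show ?thesis by auto
      next
        case False
        with IH down obtain p w where pw: "-1 \<le> p" "p \<le> w" "w \<le> y'" "m y' = w - p" "b p + b w \<le> S y'"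
          by auto
        have "b (z - w + p) \<le> b p + b w + b z"
          by (rule three_point_weight[OF b]) (use pw y' zI in auto)
        moreover have "y - m y = z - w + p" using my pw by simp
        ultimately show ?thesis using \<open>0 < g y\<close> pw y' Sy by auto
      qed
    next
      case False
      have "{x\<in>{y'<..y}. 0 < g x} = {y'<..<z}"
      proof -
        have "x < z" if "y' < x" "0 < g x" "x \<le> y" for x
          using right[of x] that False z unfolding Z by (cases x z rule: linorder_cases) auto
        moreover have "0 < g x" if "y' < x" "x < z" for x
          using left(1)[of x] that False by simp
        ultimately show ?thesis using z(2) by auto
      qed
      then have my: "m y = m y' + (z - y')" using my y' by simp
      have "0 < g y'" using left[of y'] y' False by simp
      with IH have "-1 \<le> y' - m y'" "b (y' - m y') \<le> S y'" by auto
      moreover have "m y' \<ge> 0" by (simp add: m_def)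
      ultimately have "-1 \<le> y' - m y' \<and> y' - m y' \<le> z \<and> z \<le> y \<and> m y = z - (y' - m y') \<and> b (y' - m y') + b z \<le> S y"
        using my Sy z y' by auto
      then have "\<exists>p w. -1 \<le> p \<and> p \<le> w \<and> w \<le> y \<and> m y = w - p \<and> b p + b w \<le> S y" by blast
      with False show ?thesis by simp
    qed
  qed
qed

text \<open>
At the right end the invariant gives the bound at \<open>1 - m 1\<close>: directly if \<open>g\<close> ends positive, and by
one application of the weight condition to the remaining pair if it ends negative.
\<close>
corollary sum_crossing_weights_ge:
  fixes g b :: "real \<Rightarrow> real"
  assumes cont: "continuous_on UNIV g" and start: "g (-1) < 0" and Z: "Z = {x\<in>{-1..1}. g x = 0}"
    and fin: "finite Z" and ne: "Z \<noteq> {}" and stop: "g 1 \<noteq> 0"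
    and cross: "\<And>z. z \<in> Z \<Longrightarrow> \<exists>d. d \<noteq> 0 \<and> (g has_real_derivative d) (at z)"
    and b: "\<And>s t. -1 \<le> s \<Longrightarrow> s \<le> t \<Longrightarrow> t \<le> 1 \<Longrightarrow> b s + b t \<ge> b (1 - t + s)"
  shows "b (1 - measure lebesgue (superlevel g 0)) \<le> sum b Z"
proof -
  have "\<exists>e>0. \<forall>y y'. z - e < y' \<and> y' < z \<and> z < y \<and> y < z + e \<longrightarrow>
      g y' \<noteq> 0 \<and> g y \<noteq> 0 \<and> (0 < g y \<longleftrightarrow> g y' < 0)" if "z \<in> Z" for z
  proof -
    from cross[OF that] obtain d where d: "d \<noteq> 0" "(g has_real_derivative d) (at z)" by blast
    have gz: "g z = 0" using that by (simp add: Z)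
    show ?thesis
    proof (cases "d > 0")
      case True
      from DERIV_pos_inc_left[OF d(2) True] DERIV_pos_inc_right[OF d(2) True] gz
      obtain e1 e2 where e: "e1 > 0" "e2 > 0" "\<And>h. h > 0 \<Longrightarrow> h < e1 \<Longrightarrow> g (z - h) < 0"
        "\<And>h. h > 0 \<Longrightarrow> h < e2 \<Longrightarrow> g (z + h) > 0" by auto
      have "g y' < 0 \<and> 0 < g y" if "z - min e1 e2 < y' \<and> y' < z \<and> z < y \<and> y < z + min e1 e2" for y y'
        using e(3)[of "z - y'"] e(4)[of "y - z"] that by auto
      then show ?thesis using e(1,2) by (intro exI[of _ "min e1 e2"]) fastforce
    next
      case False
      with d have d': "d < 0" by simp
      from DERIV_neg_dec_left[OF d(2) d'] DERIV_neg_dec_right[OF d(2) d'] gz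
      obtain e1 e2 where e: "e1 > 0" "e2 > 0" "\<And>h. h > 0 \<Longrightarrow> h < e1 \<Longrightarrow> g (z - h) > 0"
        "\<And>h. h > 0 \<Longrightarrow> h < e2 \<Longrightarrow> g (z + h) < 0" by auto
      have "g y' > 0 \<and> 0 > g y" if "z - min e1 e2 < y' \<and> y' < z \<and> z < y \<and> y < z + min e1 e2" for y y'
        using e(3)[of "z - y'"] e(4)[of "y - z"] that by auto
      then show ?thesis using e(1,2) by (intro exI[of _ "min e1 e2"]) fastforce
    qed
  qed
  note C = crossing_weights_partial[OF cont start Z fin this b, of 1]
  have Z1: "{z\<in>Z. z < 1} = Z" using stop unfolding Z by (auto simp: less_le)
  have sl: "{x\<in>{-1..1}. 0 < g x} = superlevel g 0" by (simp add: superlevel_def)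
  show ?thesis
  proof (cases "0 < g 1")
    case True
    then show ?thesis using C unfolding Z1 sl by simp
  next
    case False
    then obtain z w where zw: "-1 \<le> z" "z \<le> w" "w \<le> 1" "measure lebesgue (superlevel g 0) = w - z"
      "b z + b w \<le> sum b Z"
      using C stop ne unfolding Z1 sl by auto
    have "b (1 - w + z) \<le> b z + b w" by (rule b) (use zw in auto)
    also have "1 - w + z = 1 - measure lebesgue (superlevel g 0)" using zw(4) by simp
    finally show ?thesis using zw(5) by (rule order_trans)
  qed
qed

section \<open>Convexity and slopes at a level\<close>

text \<open>
Let \<open>L\<close> be the sum of the \<open>1 / q z\<close>. Jensen's inequality with weights \<open>1 / (q z L)\<close> bounds the right-hand
side below by \<open>L G((\<Sum>z\<in>Z. \<alpha> z) / L)\<close>. Since \<open>G 0 = 0\<close>, the quotient \<open>G(b p) / p\<close> increases with \<open>p\<close>,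
so it is largest at \<open>p = 1 / L\<close>, where monotonicity of \<open>G\<close> applies.
\<close>
lemma convex_harmonic_sum_le:
  fixes G :: "real \<Rightarrow> real"
  assumes conv: "convex_on {0..} G" and G0: "G 0 = 0" and mono: "mono_on {0..} G"
    and Z: "finite Z" "Z \<noteq> {}" and q: "\<And>z. z \<in> Z \<Longrightarrow> 0 < q z" and \<alpha>: "\<And>z. z \<in> Z \<Longrightarrow> 0 \<le> \<alpha> z"
    and b: "0 \<le> b" "b \<le> sum \<alpha> Z" and p: "0 < p" "p * (\<Sum>z\<in>Z. 1 / q z) \<le> 1"
  shows "G (b * p) / p \<le> (\<Sum>z\<in>Z. G (\<alpha> z * q z) / q z)"
proof -
  define L where "L = (\<Sum>z\<in>Z. 1 / q z)"
  have L: "0 < L" unfolding L_def using Z q by (intro sum_pos) auto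
  define l where "l z = 1 / (q z * L)" for z
  have l: "sum l Z = 1"
  proof -
    have "sum l Z = (\<Sum>z\<in>Z. 1 / q z) / L" by (simp add: l_def sum_divide_distrib)
    then show ?thesis using L by (simp add: L_def)
  qed
  have "G (\<Sum>z\<in>Z. l z *\<^sub>R (\<alpha> z * q z)) \<le> (\<Sum>z\<in>Z. l z * G (\<alpha> z * q z))"
    by (rule convex_on_sum[OF Z conv l]) (use L q \<alpha> in \<open>auto simp: l_def less_imp_le\<close>)
  also have "(\<Sum>z\<in>Z. l z *\<^sub>R (\<alpha> z * q z)) = (\<Sum>z\<in>Z. \<alpha> z / L)"
  proof (intro sum.cong refl)
    show "l z *\<^sub>R (\<alpha> z * q z) = \<alpha> z / L" if "z \<in> Z" for z
      using q[OF that] by (simp add: l_def)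
  qed
  also have "\<dots> = sum \<alpha> Z / L" by (simp add: sum_divide_distrib)
  also have "(\<Sum>z\<in>Z. l z * G (\<alpha> z * q z)) = (\<Sum>z\<in>Z. G (\<alpha> z * q z) / q z) / L"
    by (simp add: l_def sum_divide_distrib)
  finally have jensen: "L * G (sum \<alpha> Z / L) \<le> (\<Sum>z\<in>Z. G (\<alpha> z * q z) / q z)"
    using L by (simp add: pos_le_divide_eq mult.commute)
  have "b * p = p * L * (b / L) + (1 - p * L) * 0" using L by simp
  also have "G \<dots> \<le> p * L * G (b / L) + (1 - p * L) * G 0"
    using convex_onD[OF conv, of "p * L" 0 "b / L"] p b L by (simp add: L_def)
  also have "\<dots> = p * L * G (b / L)" using G0 by simp
  also have "\<dots> \<le> p * L * G (sum \<alpha> Z / L)"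
    using L p b \<alpha> by (intro mult_left_mono mono_onD[OF mono]) (auto intro: divide_right_mono sum_nonneg)
  finally have "G (b * p) / p \<le> L * G (sum \<alpha> Z / L)" using p by (simp add: field_simps)
  with jensen show ?thesis by linarith
qed

text \<open>
Next to each \<open>z\<close>, on the side where \<open>U\<close> is below \<open>t\<close>, the values of \<open>U\<close> stay above \<open>t - \<epsilon>\<close> on an interval of
length \<open>\<epsilon> / (|d z| + \<eta>)\<close>, and for small \<open>\<epsilon>\<close> these intervals are disjoint. The slack \<open>\<eta>\<close> absorbs the
error of the linear approximation.
\<close>
lemma superlevel_measure_drop:
  fixes U :: "real \<Rightarrow> real"
  assumes cont: "continuous_on UNIV U" and fin: "finite Z" and Z: "\<And>z. z \<in> Z \<Longrightarrow> -1 < z \<and> z < 1 \<and> U z = t"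
    and d: "\<And>z. z \<in> Z \<Longrightarrow> d z \<noteq> 0 \<and> (U has_real_derivative d z) (at z)" and \<eta>: "0 < \<eta>"
  shows "\<forall>\<^sub>F \<epsilon> in at_right 0. \<epsilon> * (\<Sum>z\<in>Z. 1 / (\<bar>d z\<bar> + \<eta>)) \<le>
      measure lebesgue (superlevel U (t - \<epsilon>)) - measure lebesgue (superlevel U t)"
proof -
  define w where "w z \<epsilon> = \<epsilon> / (\<bar>d z\<bar> + \<eta>)" for z \<epsilon>
  define I where "I z \<epsilon> = (if d z > 0 then {z - w z \<epsilon><..<z} else {z<..<z + w z \<epsilon>})" for z \<epsilon>
  have pos: "\<bar>d z\<bar> + \<eta> > 0" for z using \<eta> by (simp add: add_nonneg_pos)
  have small: "\<forall>\<^sub>F \<epsilon> in at_right 0. w z \<epsilon> < \<rho>" if "\<rho> > 0" for z \<rho>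
  proof -
    have "((\<lambda>\<epsilon>. \<epsilon> / (\<bar>d z\<bar> + \<eta>)) \<longlongrightarrow> 0 / (\<bar>d z\<bar> + \<eta>)) (at_right 0)"
      using pos[of z] by (intro tendsto_intros) simp
    then show ?thesis using order_tendstoD(2)[of _ 0 _ \<rho>] that by (simp add: w_def)
  qed
  have inside: "\<forall>\<^sub>F \<epsilon> in at_right 0. I z \<epsilon> \<subseteq> superlevel U (t - \<epsilon>) - superlevel U t" if z: "z \<in> Z" for z
  proof -
    have Uz: "U z = t" and dz: "d z \<noteq> 0" "(U has_real_derivative d z) (at z)" using Z[OF z] d[OF z] by auto
    have "((\<lambda>y. \<bar>(U y - U z) / (y - z)\<bar>) \<longlongrightarrow> \<bar>d z\<bar>) (at z)"
      using dz(2) unfolding has_field_derivative_iff by (rule tendsto_rabs)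
    then have "\<forall>\<^sub>F y in at z. \<bar>(U y - U z) / (y - z)\<bar> < \<bar>d z\<bar> + \<eta>"
      by (rule order_tendstoD) (use \<eta> in simp)
    then obtain r where r: "r > 0" "\<And>y. y \<noteq> z \<Longrightarrow> dist y z < r \<Longrightarrow> \<bar>(U y - U z) / (y - z)\<bar> < \<bar>d z\<bar> + \<eta>"
      unfolding eventually_at by blast
    obtain r' where r': "r' > 0" "\<And>y. \<bar>y - z\<bar> < r' \<Longrightarrow> (y - z) * d z < 0 \<Longrightarrow> U y < t"
    proof (cases "d z > 0")
      case True
      from DERIV_pos_inc_left[OF dz(2) True] obtain s where
        s: "s > 0" "\<And>h. h > 0 \<Longrightarrow> h < s \<Longrightarrow> U (z - h) < U z" by blast
      show ?thesis
        by (rule that[OF s(1)]) (use s(2)[of "z - _"] True Uz in \<open>auto simp: mult_less_0_iff\<close>)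
    next
      case False
      with dz have neg: "d z < 0" by simp
      from DERIV_neg_dec_right[OF dz(2) neg] obtain s where
        s: "s > 0" "\<And>h. h > 0 \<Longrightarrow> h < s \<Longrightarrow> U (z + h) < U z" by blast
      show ?thesis
        by (rule that[OF s(1)]) (use s(2)[of "_ - z"] neg Uz in \<open>auto simp: mult_less_0_iff\<close>)
    qed
    have "min (min r r') (min (z + 1) (1 - z)) > 0" using r r' Z[OF z] by auto
    from small[OF this, of z] eventually_at_right_less[of 0]
    show ?thesis
    proof eventually_elim
      case (elim \<epsilon>)
      show ?case
      proof
        fix y assume y: "y \<in> I z \<epsilon>"
        have yz: "y \<noteq> z" "\<bar>y - z\<bar> < w z \<epsilon>" "(y - z) * d z < 0"
          using y dz(1) by (auto simp: I_def mult_less_0_iff split: if_splits)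
        have "U y < t" using r'(2)[of y] yz elim by auto
        moreover have "\<bar>U y - t\<bar> < \<epsilon>"
        proof -
          have "\<bar>U y - t\<bar> / \<bar>y - z\<bar> < \<bar>d z\<bar> + \<eta>"
            using r(2)[of y] yz elim Uz by (auto simp: dist_real_def abs_divide)
          then have "\<bar>U y - t\<bar> < (\<bar>d z\<bar> + \<eta>) * \<bar>y - z\<bar>"
            using yz by (simp add: pos_divide_less_eq)
          also have "\<dots> \<le> (\<bar>d z\<bar> + \<eta>) * w z \<epsilon>"
            using yz pos[of z] by (intro mult_left_mono) auto
          also have "\<dots> = \<epsilon>" using pos[of z] by (simp add: w_def)
          finally show ?thesis .
        qed
        moreover have "y \<in> {-1..1}" using yz elim by auto
        ultimately show "y \<in> superlevel U (t - \<epsilon>) - superlevel U t"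
          by (auto simp: superlevel_def)
      qed
    qed
  qed
  have disj: "\<forall>\<^sub>F \<epsilon> in at_right 0. I z \<epsilon> \<inter> I z' \<epsilon> = {}" if "z \<noteq> z'" for z z'
  proof -
    have "\<bar>z - z'\<bar> / 2 > 0" using that by simp
    from small[OF this, of z] small[OF this, of z'] show ?thesis
    proof eventually_elim
      case (elim \<epsilon>)
      show ?case
      proof (rule ccontr)
        assume "I z \<epsilon> \<inter> I z' \<epsilon> \<noteq> {}"
        then obtain y where "y \<in> I z \<epsilon>" "y \<in> I z' \<epsilon>" by blast
        then have "\<bar>y - z\<bar> < w z \<epsilon>" "\<bar>y - z'\<bar> < w z' \<epsilon>" by (auto simp: I_def split: if_splits)
        with elim have "\<bar>y - z\<bar> + \<bar>y - z'\<bar> < \<bar>z - z'\<bar> / 2 + \<bar>z - z'\<bar> / 2"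
          by (intro add_strict_mono) (auto intro: less_trans)
        also have "\<dots> = \<bar>z - z'\<bar>" by (rule field_sum_of_halves)
        also have "\<dots> \<le> \<bar>y - z\<bar> + \<bar>y - z'\<bar>" by arith
        finally show False by simp
      qed
    qed
  qed
  have "\<forall>\<^sub>F \<epsilon> in at_right 0. \<forall>z\<in>Z. I z \<epsilon> \<subseteq> superlevel U (t - \<epsilon>) - superlevel U t"
    using inside fin by (intro eventually_ball_finite) auto
  moreover have "\<forall>\<^sub>F \<epsilon> in at_right 0. \<forall>z\<in>Z. \<forall>z'\<in>Z. z \<noteq> z' \<longrightarrow> I z \<epsilon> \<inter> I z' \<epsilon> = {}"
    using disj fin by (intro eventually_ball_finite ballI) (auto intro: eventually_mono)
  ultimately show ?thesis
    using eventually_at_right_less[of 0]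
  proof eventually_elim
    case (elim \<epsilon>)
    have w: "w z \<epsilon> > 0" for z using elim pos[of z] by (simp add: w_def)
    have m: "superlevel U s \<in> lmeasurable" for s using cont by blast
    have "\<epsilon> * (\<Sum>z\<in>Z. 1 / (\<bar>d z\<bar> + \<eta>)) = (\<Sum>z\<in>Z. measure lebesgue (I z \<epsilon>))"
    proof -
      have "measure lebesgue (I z \<epsilon>) = w z \<epsilon>" for z
        using w[of z] by (simp add: I_def less_imp_le)
      then show ?thesis by (simp add: sum_distrib_left w_def)
    qed
    also have "\<dots> = measure lebesgue (\<Union>z\<in>Z. I z \<epsilon>)"
    proof (rule measure_finite_Union[symmetric])
      show "emeasure lebesgue (I z \<epsilon>) \<noteq> \<infinity>" for z
        using w[of z] by (auto simp: I_def less_imp_le)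
      show "disjoint_family_on (\<lambda>z. I z \<epsilon>) Z" using elim by (auto simp: disjoint_family_on_def)
    qed (use fin in \<open>auto simp: I_def\<close>)
    also have "\<dots> \<le> measure lebesgue (superlevel U (t - \<epsilon>) - superlevel U t)"
    proof (rule measure_mono_fmeasurable)
      show "(\<Union>z\<in>Z. I z \<epsilon>) \<subseteq> superlevel U (t - \<epsilon>) - superlevel U t" using elim by blast
      have "I z \<epsilon> \<in> sets lebesgue" for z by (simp add: I_def)
      then show "(\<Union>z\<in>Z. I z \<epsilon>) \<in> sets lebesgue" using fin by blast
      show "superlevel U (t - \<epsilon>) - superlevel U t \<in> lmeasurable" using m by blast
    qed
    also have "\<dots> = measure lebesgue (superlevel U (t - \<epsilon>)) - measure lebesgue (superlevel U t)"
      using m elim by (intro measurable_measure_Diff) (auto simp: superlevel_def)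
    finally show ?case .
  qed
qed

text \<open>
Lowering the level from \<open>t\<close> by \<open>\<epsilon>\<close> moves the corresponding abscissa \<open>1 - \<mu> t\<close> to the left by at least
\<open>\<epsilon> L\<close>, where \<open>L\<close> is close to the sum of the \<open>1 / |d z|\<close>. So \<open>H\<close> falls by at most \<open>\<epsilon>\<close> over a distance
\<open>\<epsilon> L\<close>, which bounds its derivative by \<open>1 / L\<close>.
\<close>
lemma rearrangement_slope_le:
  fixes U H :: "real \<Rightarrow> real"
  defines "\<mu> \<equiv> \<lambda>s. measure lebesgue (superlevel U s)"
  assumes cont: "continuous_on UNIV U" and fin: "finite Z" and Z: "\<And>z. z \<in> Z \<Longrightarrow> -1 < z \<and> z < 1 \<and> U z = t"
    and d: "\<And>z. z \<in> Z \<Longrightarrow> d z \<noteq> 0 \<and> (U has_real_derivative d z) (at z)"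
    and H: "mono H" "\<And>s. 0 \<le> s \<Longrightarrow> s < t \<Longrightarrow> s \<le> H (1 - \<mu> s)"
    and t: "0 < t" "H (1 - \<mu> t) = t" and p: "(H has_real_derivative p) (at (1 - \<mu> t))" 
  shows "p * (\<Sum>z\<in>Z. 1 / \<bar>d z\<bar>) \<le> 1"
proof (cases "Z = {}")
  case False
  define L where "L \<eta> = (\<Sum>z\<in>Z. 1 / (\<bar>d z\<bar> + \<eta>))" for \<eta>
  define x where "x = 1 - \<mu> t"
  have bound: "p * L \<eta> \<le> 1" if \<eta>: "0 < \<eta>" for \<eta>
  proof -
    have L: "L \<eta> > 0" unfolding L_def
      using fin False \<eta> by (intro sum_pos) (auto simp: add_nonneg_pos)
    have lim: "((\<lambda>\<epsilon>. (H (x - \<epsilon> * L \<eta>) - H x) / (- (\<epsilon> * L \<eta>))) \<longlongrightarrow> p) (at_right 0)"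
    proof -
      have "((\<lambda>h. (H (x + h) - H x) / h) \<longlongrightarrow> p) (at 0)"
        using p by (simp add: x_def DERIV_def)
      moreover have "filterlim (\<lambda>\<epsilon>. - (\<epsilon> * L \<eta>)) (at 0) (at_right 0)"
        unfolding filterlim_at
      proof
        show "((\<lambda>\<epsilon>. - (\<epsilon> * L \<eta>)) \<longlongrightarrow> 0) (at_right 0)"
          by (rule tendsto_eq_intros refl | simp)+
        show "\<forall>\<^sub>F \<epsilon> in at_right 0. - (\<epsilon> * L \<eta>) \<in> UNIV \<and> - (\<epsilon> * L \<eta>) \<noteq> 0"
          using eventually_at_right_less[of 0] by eventually_elim (use L in auto)
      qed
      ultimately have "((\<lambda>\<epsilon>. (H (x + - (\<epsilon> * L \<eta>)) - H x) / (- (\<epsilon> * L \<eta>))) \<longlongrightarrow> p) (at_right 0)"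
        by (rule filterlim_compose)
      then show ?thesis by simp
    qed
    have "\<forall>\<^sub>F \<epsilon> in at_right 0. \<epsilon> < t" using eventually_at_right_real[OF t(1)] by eventually_elim auto
    moreover have "\<forall>\<^sub>F \<epsilon> in at_right 0. \<epsilon> * L \<eta> \<le> \<mu> (t - \<epsilon>) - \<mu> t"
      unfolding \<mu>_def L_def by (rule superlevel_measure_drop[OF cont fin]) (use Z d \<eta> in auto)
    moreover note eventually_at_right_less[of 0]
    ultimately have "\<forall>\<^sub>F \<epsilon> in at_right 0. (H (x - \<epsilon> * L \<eta>) - H x) / (- (\<epsilon> * L \<eta>)) \<le> 1 / L \<eta>"
    proof eventually_elim
      case (elim \<epsilon>)
      have "t - \<epsilon> \<le> H (1 - \<mu> (t - \<epsilon>))" using elim by (intro H) auto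
      also have "\<dots> \<le> H (x - \<epsilon> * L \<eta>)"
        using elim by (intro monoD[OF H(1)]) (auto simp: x_def)
      finally have "H x - H (x - \<epsilon> * L \<eta>) \<le> \<epsilon>" using t by (simp add: x_def)
      then have "(H x - H (x - \<epsilon> * L \<eta>)) / (\<epsilon> * L \<eta>) \<le> \<epsilon> / (\<epsilon> * L \<eta>)"
        using L elim by (intro divide_right_mono) auto
      also have "\<dots> = 1 / L \<eta>" using elim by simp
      finally show ?case by (simp add: minus_divide_right[symmetric] minus_divide_left)
    qed
    from tendsto_upperbound[OF lim this] have "p \<le> 1 / L \<eta>" by simp
    then show ?thesis using L by (simp add: field_simps)
  qed
  have "((\<lambda>\<eta>. p * L \<eta>) \<longlongrightarrow> p * (\<Sum>z\<in>Z. 1 / (\<bar>d z\<bar> + 0))) (at_right 0)"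
    unfolding L_def using d by (intro tendsto_intros) auto
  moreover have "\<forall>\<^sub>F \<eta> in at_right 0. p * L \<eta> \<le> 1"
    using eventually_at_right_less[of 0] by eventually_elim (rule bound)
  ultimately show ?thesis using tendsto_upperbound by fastforce
qed simp

section \<open>Integration over levels\<close>

text \<open>
The change of variables theorem for an injective differentiable function, for integrals that may be
infinite. The density \<open>\<phi>\<close> on the image side is obtained from truncations: where \<open>w\<close> and \<open>x\<close> are
bounded the integrand is absolutely integrable, and the truncations increase to \<open>w\<close>. The existential
form delivers the measurability of \<open>\<phi>\<close>, which is not evident from its values.
\<close>
lemma nn_integral_injective_image:
  fixes g g' w :: "real \<Rightarrow> real"
  assumes S: "S \<in> sets lebesgue" and der: "\<And>x. x \<in> S \<Longrightarrow> (g has_real_derivative g' x) (at x)"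
    and inj: "inj_on g S" and nz: "\<And>x. x \<in> S \<Longrightarrow> g' x \<noteq> 0"
    and w: "w \<in> borel_measurable lebesgue" "\<And>x. 0 \<le> w x"
  obtains \<phi> :: "real \<Rightarrow> ennreal" where "\<phi> \<in> borel_measurable lebesgue"
    "\<And>x. x \<in> S \<Longrightarrow> \<phi> (g x) = ennreal (w x / \<bar>g' x\<bar>)" "\<And>t. t \<notin> g ` S \<Longrightarrow> \<phi> t = 0"
    "(\<integral>\<^sup>+x. ennreal (w x) * indicator S x \<partial>lebesgue) = (\<integral>\<^sup>+t. \<phi> t \<partial>lebesgue)"
proof -
  define Sn where "Sn n = S \<inter> {x. w x \<le> real n} \<inter> {- real n..real n}" for n :: nat
  define \<psi> where "\<psi> t = w (inv_into S g t) / \<bar>g' (inv_into S g t)\<bar>" for t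
  define \<phi>n where "\<phi>n n t = ennreal (indicator (g ` Sn n) t *\<^sub>R \<psi> t)" for n t
  define \<phi> where "\<phi> t = (SUP n. \<phi>n n t)" for t
  have \<psi>: "\<psi> (g x) = w x / \<bar>g' x\<bar>" if "x \<in> S" for x
    using inj that by (simp add: \<psi>_def inv_into_f_f)
  have \<psi>0: "0 \<le> \<psi> t" for t using w(2) by (simp add: \<psi>_def)
  have Sn_sub: "Sn n \<subseteq> S" for n by (auto simp: Sn_def)
  have Sn_meas: "Sn n \<in> sets lebesgue" for n
  proof -
    have "{x. w x \<le> real n} \<in> sets lebesgue"
      using measurable_sets[OF w(1), of "{..real n}"] by (simp add: vimage_def)
    then show ?thesis using S by (simp add: Sn_def sets.Int)
  qed
  have inc: "Sn n \<subseteq> Sn m" if "n \<le> m" for n m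
    using that by (auto simp: Sn_def)
  have cover: "\<exists>n. x \<in> Sn n" if x: "x \<in> S" for x
  proof -
    obtain n where "max (w x) \<bar>x\<bar> \<le> real n" using real_arch_simple by blast
    then show ?thesis using x by (intro exI[of _ n]) (auto simp: Sn_def)
  qed
  have step: "\<phi>n n \<in> borel_measurable lebesgue"
    "(\<integral>\<^sup>+x. ennreal (indicator (Sn n) x *\<^sub>R w x) \<partial>lebesgue) = (\<integral>\<^sup>+t. \<phi>n n t \<partial>lebesgue)" for n
  proof -
    have "set_integrable lebesgue (Sn n) w"
      unfolding set_integrable_def
    proof (rule integrableI_bounded_set[where A="Sn n" and B="real n"])
      have "emeasure lebesgue (Sn n) \<le> emeasure lebesgue {- real n..real n}"
        by (intro emeasure_mono) (auto simp: Sn_def)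
      also have "\<dots> < \<infinity>" by simp
      finally show "emeasure lebesgue (Sn n) < \<infinity>" .
      show "(\<lambda>x. indicator (Sn n) x *\<^sub>R w x) \<in> borel_measurable lebesgue"
        using Sn_meas[of n] w(1) by measurable
      show "AE x in lebesgue. x \<in> Sn n \<longrightarrow> norm (indicator (Sn n) x *\<^sub>R w x) \<le> real n"
        using w(2) by (intro AE_I2) (auto simp: Sn_def)
    qed (use Sn_meas[of n] in auto)
    have eq: "\<bar>g' x\<bar> * \<psi> (g x) = w x" if "x \<in> Sn n" for x
    proof -
      have "x \<in> S" using that Sn_sub by blast
      then show ?thesis using \<psi>[of x] nz[of x] by simp
    qed
    have "(\<lambda>x. \<bar>g' x\<bar> * \<psi> (g x)) absolutely_integrable_on Sn n"
      using \<open>set_integrable lebesgue (Sn n) w\<close> eq by (simp cong: set_integrable_cong)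
    moreover have "integral (Sn n) (\<lambda>x. \<bar>g' x\<bar> * \<psi> (g x)) = integral (Sn n) w"
      by (rule integral_cong) (rule eq)
    moreover have "(g has_real_derivative g' x) (at x within Sn n)" if "x \<in> Sn n" for x
      using der[of x] that Sn_sub by (blast intro: has_field_derivative_at_within)
    ultimately have ab: "\<psi> absolutely_integrable_on g ` Sn n" "integral (g ` Sn n) \<psi> = integral (Sn n) w"
      using has_absolute_integral_change_of_variables_1'[of "Sn n" g g' \<psi> "integral (Sn n) w"]
        Sn_meas[of n] inj_on_subset[OF inj Sn_sub] by blast+
    from ab(1) have "(\<lambda>t. indicator (g ` Sn n) t *\<^sub>R \<psi> t) \<in> borel_measurable lebesgue"
      unfolding set_integrable_def by (rule borel_measurable_integrable)
    then show "\<phi>n n \<in> borel_measurable lebesgue" by (simp add: \<phi>n_def[abs_def])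
    have "(\<integral>\<^sup>+x. ennreal (indicator (Sn n) x *\<^sub>R w x) \<partial>lebesgue) = ennreal (LINT x:Sn n|lebesgue. w x)"
      unfolding set_lebesgue_integral_def
      by (rule nn_integral_eq_integral) (use \<open>set_integrable lebesgue (Sn n) w\<close> w in \<open>auto simp: set_integrable_def\<close>)
    also have "(LINT x:Sn n|lebesgue. w x) = integral (Sn n) w"
      by (rule set_lebesgue_integral_eq_integral) fact
    also have "\<dots> = (LINT t:g ` Sn n|lebesgue. \<psi> t)"
      using ab by (simp add: set_lebesgue_integral_eq_integral)
    also have "ennreal \<dots> = (\<integral>\<^sup>+t. \<phi>n n t \<partial>lebesgue)"
      unfolding set_lebesgue_integral_def \<phi>n_def
      by (rule nn_integral_eq_integral[symmetric]) (use ab(1) \<psi>0 in \<open>auto simp: set_integrable_def\<close>)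
    finally show "(\<integral>\<^sup>+x. ennreal (indicator (Sn n) x *\<^sub>R w x) \<partial>lebesgue) = (\<integral>\<^sup>+t. \<phi>n n t \<partial>lebesgue)" .
  qed
  have incn: "incseq \<phi>n"
    unfolding incseq_def le_fun_def \<phi>n_def
  proof (intro allI impI ennreal_leI)
    fix m n t assume "m \<le> (n :: nat)"
    from image_mono[OF inc[OF this], of g] \<psi>0[of t]
    show "indicator (g ` Sn m) t *\<^sub>R \<psi> t \<le> indicator (g ` Sn n) t *\<^sub>R \<psi> t"
      by (auto split: split_indicator)
  qed
  show ?thesis
  proof
    show "\<phi> \<in> borel_measurable lebesgue"
      unfolding \<phi>_def[abs_def] using step(1) by measurable
    show "\<phi> (g x) = ennreal (w x / \<bar>g' x\<bar>)" if x: "x \<in> S" for x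
    proof (rule antisym)
      show "\<phi> (g x) \<le> ennreal (w x / \<bar>g' x\<bar>)"
        unfolding \<phi>_def using \<psi>[OF x] w(2)[of x]
        by (intro SUP_least) (auto simp: \<phi>n_def intro!: ennreal_leI split: split_indicator)
      obtain n where "x \<in> Sn n" using cover[OF x] by blast
      then have "\<phi>n n (g x) = ennreal (w x / \<bar>g' x\<bar>)" using \<psi>[OF x] by (simp add: \<phi>n_def)
      then show "ennreal (w x / \<bar>g' x\<bar>) \<le> \<phi> (g x)"
        unfolding \<phi>_def by (metis SUP_upper UNIV_I)
    qed
    show "\<phi> t = 0" if "t \<notin> g ` S" for t
    proof -
      have "t \<notin> g ` Sn n" for n using that Sn_sub by blast
      then show ?thesis by (simp add: \<phi>_def \<phi>n_def)
    qed
    have "(\<integral>\<^sup>+x. ennreal (w x) * indicator S x \<partial>lebesgue) =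
        (\<integral>\<^sup>+x. (SUP n. ennreal (indicator (Sn n) x *\<^sub>R w x)) \<partial>lebesgue)"
    proof (rule nn_integral_cong)
      fix x
      show "ennreal (w x) * indicator S x = (SUP n. ennreal (indicator (Sn n) x *\<^sub>R w x))"
      proof (cases "x \<in> S")
        case True
        then obtain n where n: "x \<in> Sn n" using cover by blast
        have "(SUP n. ennreal (indicator (Sn n) x *\<^sub>R w x)) = ennreal (w x)"
        proof (rule antisym)
          show "(SUP n. ennreal (indicator (Sn n) x *\<^sub>R w x)) \<le> ennreal (w x)"
            using w(2)[of x] by (intro SUP_least) (auto split: split_indicator)
          show "ennreal (w x) \<le> (SUP n. ennreal (indicator (Sn n) x *\<^sub>R w x))"
            using n by (intro SUP_upper2[of n]) auto
        qed
        with True show ?thesis by simp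
      next
        case False
        then have "x \<notin> Sn n" for n using Sn_sub by blast
        with False show ?thesis by simp
      qed
    qed
    also have "\<dots> = (SUP n. \<integral>\<^sup>+x. ennreal (indicator (Sn n) x *\<^sub>R w x) \<partial>lebesgue)"
    proof (rule nn_integral_monotone_convergence_SUP)
      show "incseq (\<lambda>n x. ennreal (indicator (Sn n) x *\<^sub>R w x))"
        unfolding incseq_def le_fun_def
      proof (intro allI impI ennreal_leI)
        fix m n x assume "m \<le> (n :: nat)"
        from inc[OF this] w(2)[of x] show "indicator (Sn m) x *\<^sub>R w x \<le> indicator (Sn n) x *\<^sub>R w x"
          by (auto split: split_indicator)
      qed
      show "(\<lambda>x. ennreal (indicator (Sn n) x *\<^sub>R w x)) \<in> borel_measurable lebesgue" for n
        using Sn_meas[of n] w(1) by measurable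
    qed
    also have "\<dots> = (SUP n. \<integral>\<^sup>+t. \<phi>n n t \<partial>lebesgue)" by (simp only: step(2))
    also have "\<dots> = (\<integral>\<^sup>+t. \<phi> t \<partial>lebesgue)"
      unfolding \<phi>_def using incn step(1) by (rule nn_integral_monotone_convergence_SUP[symmetric])
    finally show "(\<integral>\<^sup>+x. ennreal (w x) * indicator S x \<partial>lebesgue) = (\<integral>\<^sup>+t. \<phi> t \<partial>lebesgue)" .
  qed
qed

text \<open>
At a point of nonzero derivative there is an \<open>n\<close> with \<open>|y - x| \<le> n |U y - U x|\<close> whenever
\<open>|y - x| \<le> 1 / n\<close>. For fixed \<open>n\<close> these points form a closed set, on which \<open>U\<close> is injective within any
half-open interval of length \<open>1 / n\<close>.
\<close>
lemma countable_injectivity_partition: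
  fixes U :: "real \<Rightarrow> real"
  assumes cont: "continuous_on UNIV U"
  obtains B :: "nat \<Rightarrow> real set" where "\<And>k. B k \<in> sets borel" "\<And>k. inj_on U (B k)" "disjoint_family B"
    "\<And>x d. (U has_real_derivative d) (at x) \<Longrightarrow> d \<noteq> 0 \<Longrightarrow> x \<in> (\<Union>k. B k)"
proof -
  define N where "N n = real (Suc n)" for n
  have N: "N n > 0" for n by (simp add: N_def)
  define C where "C n = (\<Inter>h\<in>{h. \<bar>h\<bar> \<le> 1 / N n}. {x. \<bar>h\<bar> \<le> N n * \<bar>U (x + h) - U x\<bar>})" for n
  define A where "A p = C (fst p) \<inter> {real_of_int (snd p) / N (fst p)..<(real_of_int (snd p) + 1) / N (fst p)}" for p :: "nat \<times> int"
  define B where "B = disjointed (\<lambda>k. A (from_nat k))"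
  have "closed (C n)" for n :: nat
    unfolding C_def
    by (intro closed_INT ballI closed_Collect_le continuous_intros continuous_on_compose2[OF cont]) auto
  then have "C n \<in> sets borel" for n by (rule borel_closed)
  then have A_meas: "A p \<in> sets borel" for p
    unfolding A_def by (intro sets.Int) auto
  have A_inj: "inj_on U (A p)" for p
  proof (rule inj_onI)
    fix x y assume xy: "x \<in> A p" "y \<in> A p" "U x = U y"
    let ?N = "N (fst p)" and ?j = "real_of_int (snd p)"
    have "?j / ?N \<le> x" "x < ?j / ?N + 1 / ?N" "?j / ?N \<le> y" "y < ?j / ?N + 1 / ?N"
      using xy by (auto simp: A_def add_divide_distrib)
    then have "\<bar>y - x\<bar> \<le> 1 / ?N" by linarith
    then have "\<bar>y - x\<bar> \<le> ?N * \<bar>U (x + (y - x)) - U x\<bar>"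
      using xy(1) unfolding A_def C_def by blast
    then show "x = y" using xy(3) by simp
  qed
  show ?thesis
  proof
    have "range (disjointed (\<lambda>k. A (from_nat k))) \<subseteq> sets borel"
      by (rule sets.range_disjointed_sets) (use A_meas in blast)
    then show "B k \<in> sets borel" for k by (auto simp: B_def)
    show "inj_on U (B k)" for k
      unfolding B_def by (rule inj_on_subset[OF A_inj disjointed_subset])
    show "disjoint_family B" unfolding B_def by (rule disjoint_family_disjointed)
    fix x d assume d: "(U has_real_derivative d) (at x)" "d \<noteq> 0"
    have "((\<lambda>h. \<bar>(U (x + h) - U x) / h\<bar>) \<longlongrightarrow> \<bar>d\<bar>) (at 0)"
      using d(1) unfolding DERIV_def by (rule tendsto_rabs)
    then have "\<forall>\<^sub>F h in at 0. \<bar>d\<bar> / 2 < \<bar>(U (x + h) - U x) / h\<bar>"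
      by (rule order_tendstoD) (use d(2) in simp)
    then obtain r where r: "r > 0" "\<And>h. h \<noteq> 0 \<Longrightarrow> \<bar>h\<bar> < r \<Longrightarrow> \<bar>d\<bar> / 2 < \<bar>(U (x + h) - U x) / h\<bar>"
      unfolding eventually_at dist_real_def diff_zero by blast
    obtain n :: nat where "max (1 / r) (2 / \<bar>d\<bar>) < real n" using reals_Archimedean2 by blast
    then have n: "max (1 / r) (2 / \<bar>d\<bar>) < N n" unfolding N_def of_nat_Suc by linarith
    have n1: "1 / N n < r" using n N[of n] r(1) by (simp add: field_simps)
    have n2: "1 / N n \<le> \<bar>d\<bar> / 2" using n N[of n] d(2) by (simp add: field_simps)
    have "x \<in> C n"
      unfolding C_def
    proof (intro INT_I CollectI)
      fix h assume "h \<in> {h. \<bar>h\<bar> \<le> 1 / N n}"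
      then have h: "\<bar>h\<bar> \<le> 1 / N n" by simp
      show "\<bar>h\<bar> \<le> N n * \<bar>U (x + h) - U x\<bar>"
      proof (cases "h = 0")
        case False
        have "\<bar>d\<bar> / 2 < \<bar>(U (x + h) - U x) / h\<bar>" using False h n1 by (intro r(2)) auto
        then have "1 / N n < \<bar>(U (x + h) - U x) / h\<bar>" using n2 by linarith
        then have "1 / N n < \<bar>U (x + h) - U x\<bar> / \<bar>h\<bar>" by (simp only: abs_divide)
        then show ?thesis using N[of n] False by (simp add: field_simps)
      qed simp
    qed
    moreover define j where "j = \<lfloor>N n * x\<rfloor>"
    have "real_of_int j \<le> N n * x" "N n * x < real_of_int j + 1" by (auto simp: j_def)
    then have "real_of_int j / N n \<le> x" "x < (real_of_int j + 1) / N n"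
      using N[of n] by (auto simp: field_simps)
    ultimately have "x \<in> A (n, j)" by (simp add: A_def)
    then have "x \<in> (\<Union>k. A (from_nat k))" by (intro UN_I[of "to_nat (n, j)"]) auto
    then show "x \<in> (\<Union>k. B k)" by (simp add: B_def UN_disjointed_eq)
  qed
qed

lemma ex_borel_derivative:
  fixes f :: "real \<Rightarrow> real"
  assumes f: "f \<in> borel_measurable borel"
  obtains f' where "f' \<in> borel_measurable borel"
    "\<And>x. f differentiable at x \<Longrightarrow> (f has_real_derivative f' x) (at x)"
proof
  let ?f' = "\<lambda>x. lim (\<lambda>n. (f (x + inverse (real (Suc n))) - f x) / inverse (real (Suc n)))"
  show "?f' \<in> borel_measurable borel" using f by measurable
  fix x assume "f differentiable at x"
  then obtain D where D: "(f has_real_derivative D) (at x)" using real_differentiable_def by blast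
  then have "((\<lambda>h. (f (x + h) - f x) / h) \<longlongrightarrow> D) (at 0)" by (simp add: DERIV_def)
  moreover have "filterlim (\<lambda>n. inverse (real (Suc n))) (at 0) sequentially"
    unfolding filterlim_at using LIMSEQ_inverse_real_of_nat by auto
  ultimately have "(\<lambda>n. (f (x + inverse (real (Suc n))) - f x) / inverse (real (Suc n))) \<longlonglongrightarrow> D"
    by (rule filterlim_compose)
  then have "?f' x = D" by (rule limI)
  with D show "(f has_real_derivative ?f' x) (at x)" by simp
qed

section \<open>The monotone rearrangement\<close>

lemma superlevel_antimono: "s \<le> t \<Longrightarrow> superlevel U t \<subseteq> superlevel U s"
  by (auto simp: superlevel_def)

lemma measure_superlevel_antimono:
  assumes "continuous_on UNIV U" "s \<le> t"
  shows "measure lebesgue (superlevel U t) \<le> measure lebesgue (superlevel U s)"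
  using assms(2)
  by (intro measure_mono_fmeasurable superlevel_lmeasurable fmeasurableD[OF superlevel_lmeasurable] assms(1))
    (auto simp: superlevel_def)

lemma measure_superlevel_le:
  assumes "continuous_on UNIV U"
  shows "measure lebesgue (superlevel U t) \<le> 2"
proof -
  have "measure lebesgue (superlevel U t) \<le> measure lebesgue {-1..1::real}"
    by (intro measure_mono_fmeasurable fmeasurableD[OF superlevel_lmeasurable] assms)
      (auto simp: superlevel_def)
  then show ?thesis by simp
qed

lemma measure_superlevel_right_continuous:
  assumes cont: "continuous_on UNIV U"
  shows "(\<lambda>n. measure lebesgue (superlevel U (t + inverse (real (Suc n))))) \<longlonglongrightarrow> measure lebesgue (superlevel U t)"
proof -
  have "(\<Union>n. superlevel U (t + inverse (real (Suc n)))) = superlevel U t"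
  proof (rule antisym)
    show "superlevel U t \<subseteq> (\<Union>n. superlevel U (t + inverse (real (Suc n))))"
    proof
      fix x assume x: "x \<in> superlevel U t"
      then have "0 < U x - t" by (simp add: superlevel_def)
      then obtain n where "inverse (real (Suc n)) < U x - t" using reals_Archimedean by blast
      with x show "x \<in> (\<Union>n. superlevel U (t + inverse (real (Suc n))))"
        by (intro UN_I[of n]) (auto simp: superlevel_def)
    qed
    show "(\<Union>n. superlevel U (t + inverse (real (Suc n)))) \<subseteq> superlevel U t"
    proof
      fix x assume "x \<in> (\<Union>n. superlevel U (t + inverse (real (Suc n))))"
      then obtain n where "x \<in> {-1..1}" "t + inverse (real (Suc n)) < U x" by (auto simp: superlevel_def)
      moreover have "inverse (real (Suc n)) > 0" by simp
      ultimately have "t < U x" by linarith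
      with \<open>x \<in> {-1..1}\<close> show "x \<in> superlevel U t" by (simp add: superlevel_def)
    qed
  qed
  moreover have "(\<lambda>n. measure lebesgue (superlevel U (t + inverse (real (Suc n))))) \<longlonglongrightarrow>
      measure lebesgue (\<Union>n. superlevel U (t + inverse (real (Suc n))))"
  proof (rule Lim_measure_incseq)
    show "range (\<lambda>n. superlevel U (t + inverse (real (Suc n)))) \<subseteq> sets lebesgue"
      using superlevel_lmeasurable[OF cont] by (auto intro: fmeasurableD)
    show "incseq (\<lambda>n. superlevel U (t + inverse (real (Suc n))))"
    proof (rule monoI)
      fix m n :: nat assume "m \<le> n"
      then have "inverse (real (Suc n)) \<le> inverse (real (Suc m))" by (intro le_imp_inverse_le) auto
      then show "superlevel U (t + inverse (real (Suc m))) \<le> superlevel U (t + inverse (real (Suc n)))"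
        by (intro superlevel_antimono add_left_mono)
    qed
    show "emeasure lebesgue (\<Union>n. superlevel U (t + inverse (real (Suc n)))) \<noteq> \<infinity>"
      unfolding calculation using fmeasurableD2[OF superlevel_lmeasurable[OF cont]] by simp
  qed
  ultimately show ?thesis by simp
qed

lemma measure_superlevel_left_continuous:
  assumes cont: "continuous_on UNIV U" and fin: "finite {x\<in>{-1..1}. U x = t}" and c: "0 < c"
  shows "(\<lambda>n. measure lebesgue (superlevel U (t - c * inverse (real (Suc n))))) \<longlonglongrightarrow> measure lebesgue (superlevel U t)"
proof -
  let ?A = "\<lambda>n. superlevel U (t - c * inverse (real (Suc n)))"
  have eq: "(\<Inter>n. ?A n) = superlevel U t \<union> {x\<in>{-1..1}. U x = t}"
  proof (rule antisym)
    show "(\<Inter>n. ?A n) \<subseteq> superlevel U t \<union> {x\<in>{-1..1}. U x = t}"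
    proof
      fix x assume x: "x \<in> (\<Inter>n. ?A n)"
      have "t - c * inverse (real (Suc n)) \<le> U x" for n
      proof -
        have "x \<in> ?A n" using x by blast
        then show ?thesis by (simp only: superlevel_def mem_Collect_eq less_imp_le)
      qed
      moreover have "(\<lambda>n. t - c * inverse (real (Suc n))) \<longlonglongrightarrow> t - c * 0"
        by (intro tendsto_intros LIMSEQ_inverse_real_of_nat)
      ultimately have "t - c * 0 \<le> U x" by (intro LIMSEQ_le_const2) auto
      then show "x \<in> superlevel U t \<union> {x\<in>{-1..1}. U x = t}"
        using x by (auto simp: superlevel_def)
    qed
    show "superlevel U t \<union> {x\<in>{-1..1}. U x = t} \<subseteq> (\<Inter>n. ?A n)"
    proof (intro subsetI INT_I)
      fix x n assume "x \<in> superlevel U t \<union> {x\<in>{-1..1}. U x = t}"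
      then have "x \<in> {-1..1}" "t \<le> U x" by (auto simp: superlevel_def)
      moreover have "0 < c * inverse (real (Suc n))" using c by simp
      ultimately have "t - c * inverse (real (Suc n)) < U x" by linarith
      with \<open>x \<in> {-1..1}\<close> show "x \<in> ?A n" by (simp only: superlevel_def mem_Collect_eq simp_thms)
    qed
  qed
  have null: "{x\<in>{-1..1}. U x = t} \<in> null_sets lebesgue"
    using fin by (simp add: negligible_finite negligible_iff_null_sets[symmetric])
  have "(\<lambda>n. measure lebesgue (?A n)) \<longlonglongrightarrow> measure lebesgue (\<Inter>n. ?A n)"
  proof (rule Lim_measure_decseq)
    show "range ?A \<subseteq> sets lebesgue"
      using superlevel_lmeasurable[OF cont] by (auto intro: fmeasurableD)
    show "decseq ?A"
    proof (rule antimonoI)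
      fix m n :: nat assume "m \<le> n"
      then have "inverse (real (Suc n)) \<le> inverse (real (Suc m))" by (intro le_imp_inverse_le) auto
      then have "c * inverse (real (Suc n)) \<le> c * inverse (real (Suc m))" using c by simp
      then show "?A m \<ge> ?A n"
        by (intro superlevel_antimono diff_left_mono)
    qed
    show "emeasure lebesgue (?A i) \<noteq> \<infinity>" for i
      using fmeasurableD2[OF superlevel_lmeasurable[OF cont]] by simp
  qed
  moreover have "measure lebesgue (\<Inter>n. ?A n) = measure lebesgue (superlevel U t)"
    unfolding eq using superlevel_lmeasurable[OF cont] null by (intro measure_Un_null_set) (auto intro: fmeasurableD)
  ultimately show ?thesis by simp
qed

lemma monotone_rearrangement_eq:
  "monotone_rearrangement u x =
    measure lborel {t. 0 \<le> t \<and> superlevel u t \<noteq> {} \<and> x \<in> {1 - measure lebesgue (superlevel u t)..1}}"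
proof -
  have "monotone_rearrangement u x = (\<integral>t. indicator {t. 0 \<le> t \<and> superlevel u t \<noteq> {} \<and>
      x \<in> {1 - measure lebesgue (superlevel u t)..1}} t \<partial>lborel)"
    unfolding monotone_rearrangement_def set_lebesgue_integral_def set_rearrangement_def
    by (intro Bochner_Integration.integral_cong refl) (auto split: split_indicator)
  then show ?thesis by simp
qed

text \<open>
The set of levels \<open>t\<close> whose rearranged superlevel set contains \<open>x\<close> is an initial segment of the half-line,
so the rearrangement at \<open>x\<close> is the length of this segment.
\<close>
lemma rearrangement_level_set:
  fixes U :: "real \<Rightarrow> real"
  assumes cont: "continuous_on UNIV U"
  defines "T \<equiv> \<lambda>x. {t. 0 \<le> t \<and> superlevel U t \<noteq> {} \<and> x \<in> {1 - measure lebesgue (superlevel U t)..1}}"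
  shows "T x \<in> lmeasurable" "monotone_rearrangement U x = measure lebesgue (T x)"
    "t \<in> T x \<Longrightarrow> {0..t} \<subseteq> T x" "t \<ge> 0 \<Longrightarrow> t \<notin> T x \<Longrightarrow> T x \<subseteq> {0..t}"
proof -
  have down: "{0..t} \<subseteq> T x" if "t \<in> T x" for t x
  proof
    fix s assume s: "s \<in> {0..t}"
    then have "superlevel U t \<subseteq> superlevel U s" by (auto simp: superlevel_def)
    with that s measure_superlevel_antimono[OF cont, of s t] show "s \<in> T x" by (auto simp: T_def)
  qed
  then show "t \<in> T x \<Longrightarrow> {0..t} \<subseteq> T x" .
  show "T x \<subseteq> {0..t}" if "t \<ge> 0" "t \<notin> T x"
  proof
    fix s assume s: "s \<in> T x"
    then have "s \<ge> 0" by (simp add: T_def)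
    moreover have "\<not> t < s"
    proof
      assume "t < s"
      with that have "t \<in> {0..s}" by simp
      with down[OF s] that show False by blast
    qed
    ultimately show "s \<in> {0..t}" by simp
  qed
  have "is_interval (T x)"
    unfolding is_interval_1
  proof (intro ballI allI impI)
    fix a b c assume ab: "a \<in> T x" "b \<in> T x" "a \<le> c \<and> c \<le> b"
    then have "c \<in> {0..b}" by (auto simp: T_def)
    with down[OF ab(2)] show "c \<in> T x" by blast
  qed
  then have b: "T x \<in> sets borel" by (rule real_interval_borel_measurable)
  have "compact (U ` {-1..1})"
    by (intro compact_continuous_image continuous_on_subset[OF cont]) auto
  then have "bdd_above (U ` {-1..1})" by (intro bounded_imp_bdd_above compact_imp_bounded)
  then obtain M where M: "\<And>y. y \<in> {-1..1} \<Longrightarrow> U y \<le> M" unfolding bdd_above_def by blast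
  have "T x \<subseteq> {0..M}"
  proof
    fix t assume "t \<in> T x"
    then have "0 \<le> t" "superlevel U t \<noteq> {}" by (simp_all add: T_def)
    then obtain y where "y \<in> {-1..1}" "t < U y" by (auto simp: superlevel_def)
    with M[of y] \<open>0 \<le> t\<close> show "t \<in> {0..M}" by simp
  qed
  moreover have "T x \<in> sets lebesgue" using b by simp
  ultimately show "T x \<in> lmeasurable" by (rule fmeasurableI2[OF lmeasurable_compact[OF compact_Icc]])
  show "monotone_rearrangement U x = measure lebesgue (T x)"
  proof -
    have "monotone_rearrangement U x = measure lborel (T x)"
      by (simp only: monotone_rearrangement_eq T_def)
    then show ?thesis using b by simp
  qed
qed

lemma rearrangement_ge:
  assumes cont: "continuous_on UNIV U" and "0 \<le> t" "superlevel U t \<noteq> {}"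
    "1 - measure lebesgue (superlevel U t) \<le> x" "x \<le> 1"
  shows "t \<le> monotone_rearrangement U x"
proof -
  have "{0..t} \<subseteq> {t. 0 \<le> t \<and> superlevel U t \<noteq> {} \<and> x \<in> {1 - measure lebesgue (superlevel U t)..1}}"
    by (rule rearrangement_level_set(3)[OF cont]) (use assms in auto)
  then have "measure lebesgue {0..t} \<le> monotone_rearrangement U x"
    unfolding rearrangement_level_set(2)[OF cont]
    by (intro measure_mono_fmeasurable rearrangement_level_set(1)[OF cont]) auto
  with \<open>0 \<le> t\<close> show ?thesis by simp
qed

lemma rearrangement_le:
  assumes cont: "continuous_on UNIV U" and "0 \<le> t"
    and "x < 1 - measure lebesgue (superlevel U t) \<or> superlevel U t = {}"
  shows "monotone_rearrangement U x \<le> t"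
proof -
  have "{t. 0 \<le> t \<and> superlevel U t \<noteq> {} \<and> x \<in> {1 - measure lebesgue (superlevel U t)..1}} \<subseteq> {0..t}"
    by (rule rearrangement_level_set(4)[OF cont]) (use assms in auto)
  then have "monotone_rearrangement U x \<le> measure lebesgue {0..t}"
    unfolding rearrangement_level_set(2)[OF cont]
    by (intro measure_mono_fmeasurable fmeasurableD[OF rearrangement_level_set(1)[OF cont]]) auto
  with \<open>0 \<le> t\<close> show ?thesis by simp
qed

lemma rearrangement_nonneg: "0 \<le> monotone_rearrangement u x"
  by (simp add: monotone_rearrangement_eq)

lemma rearrangement_mono:
  assumes cont: "continuous_on UNIV U" and "x \<le> y" "y \<le> 1"
  shows "monotone_rearrangement U x \<le> monotone_rearrangement U y"
  unfolding rearrangement_level_set(2)[OF cont]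
  by (intro measure_mono_fmeasurable rearrangement_level_set(1)[OF cont]
      fmeasurableD[OF rearrangement_level_set(1)[OF cont]]) (use assms in auto)

lemma rearrangement_gt:
  assumes cont: "continuous_on UNIV U" and "0 \<le> t"
    and x: "1 - measure lebesgue (superlevel U t) < x" "x \<le> 1"
  shows "t < monotone_rearrangement U x"
proof -
  have "1 - x < measure lebesgue (superlevel U t)" using x by simp
  from order_tendstoD(1)[OF measure_superlevel_right_continuous[OF cont] this]
  obtain n where n: "1 - x < measure lebesgue (superlevel U (t + inverse (real (Suc n))))"
    using eventually_happens'[OF sequentially_bot] by blast
  have pos: "inverse (real (Suc n)) > 0" by simp
  have "superlevel U (t + inverse (real (Suc n))) \<noteq> {}" using n x by auto
  then have "t + inverse (real (Suc n)) \<le> monotone_rearrangement U x"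
    using n x \<open>0 \<le> t\<close> pos by (intro rearrangement_ge[OF cont]) linarith+
  with pos show ?thesis by linarith
qed

lemma rearrangement_eq_imp:
  assumes cont: "continuous_on UNIV U" and t: "0 < t" and fin: "finite {x\<in>{-1..1}. U x = t}"
    and x: "monotone_rearrangement U x = t" "x \<le> 1"
  shows "x = 1 - measure lebesgue (superlevel U t)"
proof (rule antisym)
  show "x \<le> 1 - measure lebesgue (superlevel U t)"
    using rearrangement_gt[OF cont, of t x] t x by force
  show "1 - measure lebesgue (superlevel U t) \<le> x"
  proof (rule ccontr)
    assume "\<not> ?thesis"
    then have "measure lebesgue (superlevel U t) < 1 - x" by simp
    from order_tendstoD(2)[OF measure_superlevel_left_continuous[OF cont fin t] this]
    obtain n where n: "measure lebesgue (superlevel U (t - t * inverse (real (Suc n)))) < 1 - x"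
      using eventually_happens'[OF sequentially_bot] by blast
    have "t * inverse (real (Suc n)) \<le> t * 1"
      using t by (intro mult_left_mono) (auto simp: inverse_le_1_iff)
    then have "monotone_rearrangement U x \<le> t - t * inverse (real (Suc n))"
      using n by (intro rearrangement_le[OF cont]) auto
    moreover have "0 < t * inverse (real (Suc n))" using t by simp
    ultimately show False using x by linarith
  qed
qed

text \<open>
The superlevel set of the rearrangement at \<open>t\<close> is the interval of length \<open>|{U > t}|\<close> that ends at 1, up to
the left end point. So \<open>U\<close> and \<open>H\<close> have the same distribution on \<open>{-1..1}\<close>.
\<close>
lemma rearrangement_equimeasurable:
  fixes U H :: "real \<Rightarrow> real"
  assumes cont: "continuous_on UNIV U" and nonneg: "\<And>x. 0 \<le> U x"
    and H: "H \<in> borel_measurable borel" "\<And>x. x \<in> {-1..1} \<Longrightarrow> H x = monotone_rearrangement U x"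
    and \<phi>: "\<phi> \<in> borel_measurable borel"
  shows "(\<integral>\<^sup>+x\<in>{-1..1}. \<phi> (H x) \<partial>lborel) = (\<integral>\<^sup>+x\<in>{-1..1}. \<phi> (U x) \<partial>lborel)"
proof -
  have U: "U \<in> borel_measurable borel" using cont by (rule borel_measurable_continuous_onI)
  let ?M = "restrict_space lborel {-1..1::real}"
  have meas: "f \<in> ?M \<rightarrow>\<^sub>M borel" if "f \<in> borel_measurable borel" for f :: "real \<Rightarrow> real"
    using that by (intro measurable_restrict_space1) simp
  have em: "emeasure (distr ?M borel f) {t<..} = emeasure lborel {x\<in>{-1..1}. t < f x}"
    if "f \<in> borel_measurable borel" for f :: "real \<Rightarrow> real" and t
  proof -
    have "f -` {t<..} \<inter> space ?M = {x\<in>{-1..1}. t < f x}" by (auto simp: space_restrict_space)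
    moreover have "emeasure ?M {x\<in>{-1..1}. t < f x} = emeasure lborel {x\<in>{-1..1}. t < f x}"
      by (rule emeasure_restrict_space) auto
    ultimately show ?thesis using meas[OF that] by (simp add: emeasure_distr)
  qed
  have level: "emeasure lborel {x\<in>{-1..1}. t < H x} = emeasure lborel {x\<in>{-1..1}. t < U x}" for t
  proof (cases "t < 0")
    case True
    have "{x\<in>{-1..1}. t < H x} = {-1..1}" "{x\<in>{-1..1}. t < U x} = {-1..1}"
      using True H(2) rearrangement_nonneg[of U] nonneg by (auto intro: less_le_trans)
    then show ?thesis by simp
  next
    case False
    let ?m = "measure lebesgue (superlevel U t)"
    have m: "0 \<le> ?m" "?m \<le> 2" using measure_superlevel_le[OF cont] by auto
    have Hm: "{x\<in>{-1..1}. t < H x} \<in> sets lborel"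
      using H(1) by measurable
    have "emeasure lborel {x\<in>{-1..1}. t < H x} = ennreal ?m"
    proof (rule antisym)
      have "{x\<in>{-1..1}. t < H x} \<subseteq> {1 - ?m..1}"
      proof
        fix x assume "x \<in> {x\<in>{-1..1}. t < H x}"
        then have x: "x \<in> {-1..1}" "t < H x" by auto
        have "\<not> x < 1 - ?m" using rearrangement_le[OF cont, of t x] H(2)[OF x(1)] x False by auto
        with x show "x \<in> {1 - ?m..1}" by simp
      qed
      then have "emeasure lborel {x\<in>{-1..1}. t < H x} \<le> emeasure lborel {1 - ?m..1}"
        by (intro emeasure_mono) auto
      then show "emeasure lborel {x\<in>{-1..1}. t < H x} \<le> ennreal ?m" using m by simp
      have "{1 - ?m<..1} \<subseteq> {x\<in>{-1..1}. t < H x}"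
      proof
        fix x assume "x \<in> {1 - ?m<..1}"
        then have x: "x \<in> {-1..1}" "1 - ?m < x" using m by auto
        then have "t < H x" using rearrangement_gt[OF cont, of t x] H(2)[OF x(1)] False by auto
        with x show "x \<in> {x\<in>{-1..1}. t < H x}" by simp
      qed
      then have "emeasure lborel {1 - ?m<..1} \<le> emeasure lborel {x\<in>{-1..1}. t < H x}"
        using Hm by (intro emeasure_mono) auto
      then show "ennreal ?m \<le> emeasure lborel {x\<in>{-1..1}. t < H x}" using m by simp
    qed
    also have "ennreal ?m = emeasure lborel (superlevel U t)"
    proof -
      have "superlevel U t \<in> sets lborel"
        unfolding superlevel_def using U by measurable
      then show ?thesis
        using emeasure_eq_measure2[OF superlevel_lmeasurable[OF cont, of t]] by simp
    qed
    finally show ?thesis by (simp add: superlevel_def)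
  qed
  have "distr ?M borel H = distr ?M borel U"
  proof (rule measure_eqI_lessThan)
    fix t
    have "emeasure lborel {x\<in>{-1..1}. t < H x} \<le> emeasure lborel {-1..1::real}"
      by (intro emeasure_mono) auto
    also have "\<dots> < \<infinity>" by simp
    finally show "emeasure (distr ?M borel H) {t<..} < \<infinity>" unfolding em[OF H(1)] .
    show "emeasure (distr ?M borel H) {t<..} = emeasure (distr ?M borel U) {t<..}"
      unfolding em[OF H(1)] em[OF U] by (rule level)
  qed auto
  moreover have "(\<integral>\<^sup>+x\<in>{-1..1}. \<phi> (f x) \<partial>lborel) = integral\<^sup>N (distr ?M borel f) \<phi>"
    if "f \<in> borel_measurable borel" for f :: "real \<Rightarrow> real"
    using meas[OF that] \<phi> by (simp add: nn_integral_distr nn_integral_restrict_space)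
  ultimately show ?thesis using H(1) U by simp
qed

section \<open>The rearrangement inequality\<close>

lemma nonzero_derivative_imp_eventually_ne:
  fixes U :: "real \<Rightarrow> real"
  assumes "(U has_real_derivative d) (at z)" "d \<noteq> 0"
  shows "\<forall>\<^sub>F y in at z. U y \<noteq> U z"
proof -
  have "((\<lambda>y. (U y - U z) / (y - z)) \<longlongrightarrow> d) (at z)"
    using assms(1) by (simp add: has_field_derivative_iff)
  from tendsto_imp_eventually_ne[OF this assms(2)] show ?thesis
    by eventually_elim auto
qed

text \<open>
An accumulation point of the level set would lie on the level and have nonzero derivative, but such a
point is isolated in the level set.
\<close>
lemma finite_regular_level_set:
  fixes U :: "real \<Rightarrow> real"
  assumes cont: "continuous_on UNIV U"
    and reg: "\<And>z. z \<in> {a..b} \<Longrightarrow> U z = t \<Longrightarrow> \<exists>d. d \<noteq> 0 \<and> (U has_real_derivative d) (at z)"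
  shows "finite {z\<in>{a..b}. U z = t}"
proof (rule ccontr)
  let ?Z = "{z\<in>{a..b}. U z = t}"
  assume "infinite ?Z"
  then obtain z where z: "z \<in> {a..b}" "z islimpt ?Z"
    using compact_eq_Bolzano_Weierstrass[of "{a..b}"] by (metis (no_types, lifting) compact_Icc mem_Collect_eq subsetI)
  have "closed {x. U x = t}"
    using cont by (intro closed_Collect_eq) auto
  moreover have "z islimpt {x. U x = t}" by (rule islimpt_subset[OF z(2)]) auto
  ultimately have "U z = t" by (auto simp: closed_limpt)
  with reg[OF z(1)] obtain d where "d \<noteq> 0" "(U has_real_derivative d) (at z)" by blast
  from nonzero_derivative_imp_eventually_ne[OF this(2,1)] \<open>U z = t\<close>
  have "\<forall>\<^sub>F y in at z. y \<notin> ?Z" by (auto elim: eventually_mono)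
  with z(2) show False by (simp add: islimpt_iff_eventually)
qed

lemma mono_inj_on_pos_derivative:
  fixes H :: "real \<Rightarrow> real"
  assumes "mono H" and der: "\<And>x. x \<in> P \<Longrightarrow> (H has_real_derivative H' x) (at x) \<and> 0 < H' x"
  shows "inj_on H P"
proof -
  have less: "H x < H y" if "x \<in> P" "x < y" for x y
  proof -
    from DERIV_pos_inc_right[of H "H' x" x] der[OF that(1)] obtain e where
      e: "e > 0" "\<And>h. 0 < h \<Longrightarrow> h < e \<Longrightarrow> H x < H (x + h)" by blast
    have "H x < H (x + min (e / 2) (y - x))" using e that by (intro e(2)) auto
    also have "\<dots> \<le> H y" by (intro monoD[OF \<open>mono H\<close>]) auto
    finally show ?thesis .
  qed
  show ?thesis
  proof (rule inj_onI, rule ccontr)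
    fix x y assume "x \<in> P" "y \<in> P" "H x = H y" "x \<noteq> y"
    with less[of x y] less[of y x] show False by (cases x y rule: linorder_cases) auto
  qed
qed

text \<open>
The comparison of the two coarea integrands at a regular level \<open>t\<close>. Regularity at \<open>-1\<close> excludes \<open>t = 0\<close>,
so \<open>U\<close> starts strictly below the level.
\<close>
lemma level_inequality:
  fixes G :: "real \<Rightarrow> real" and b U H d :: "real \<Rightarrow> real"
  defines "\<mu> \<equiv> \<lambda>s. measure lebesgue (superlevel U s)"
  assumes conv: "convex_on {0..} G" and G0: "G 0 = 0" and mono: "mono_on {0..} G"
    and b: "\<And>x. x \<in> {-1..1} \<Longrightarrow> 0 \<le> b x"
      "\<And>s t. -1 \<le> s \<Longrightarrow> s \<le> t \<Longrightarrow> t \<le> 1 \<Longrightarrow> b s + b t \<ge> b (1 - t + s)"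
    and cont: "continuous_on UNIV U" and U0: "U (-1) = 0"
    and H: "mono H" "\<And>x. x \<in> {-1..1} \<Longrightarrow> H x = monotone_rearrangement U x"
    and reg: "\<And>z. z \<in> {-1..1} \<Longrightarrow> U z = t \<Longrightarrow>
        -1 < z \<and> z < 1 \<and> d z \<noteq> 0 \<and> (U has_real_derivative d z) (at z)"
    and x: "-1 < x" "x < 1" "H x = t" and p: "(H has_real_derivative p) (at x)" "0 < p"
  defines "Z \<equiv> {z\<in>{-1..1}. U z = t}"
  shows "finite Z" "G (b x * p) / p \<le> (\<Sum>z\<in>Z. G (b z * \<bar>d z\<bar>) / \<bar>d z\<bar>)"
proof -
  have Z: "-1 < z \<and> z < 1 \<and> U z = t" "d z \<noteq> 0 \<and> (U has_real_derivative d z) (at z)" if "z \<in> Z" for z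
    using reg[of z] that by (auto simp: Z_def)
  show fin: "finite Z"
    unfolding Z_def by (rule finite_regular_level_set[OF cont]) (use reg in blast)
  have "0 \<le> t" using x H(2)[of x] rearrangement_nonneg[of U x] by simp
  moreover have "t \<noteq> 0" using reg[of "-1"] U0 by auto
  ultimately have t: "0 < t" by simp
  have x_eq: "x = 1 - \<mu> t"
    unfolding \<mu>_def by (rule rearrangement_eq_imp[OF cont t]) (use fin H(2)[of x] x in \<open>auto simp: Z_def\<close>)
  then have "\<mu> t \<noteq> 0" using x by simp
  then have ne: "superlevel U t \<noteq> {}" by (auto simp: \<mu>_def)
  then obtain y where y: "y \<in> {-1..1}" "t < U y" by (auto simp: superlevel_def)
  have "\<exists>z\<ge>-1. z \<le> y \<and> U z = t"
    using y U0 t by (intro IVT' continuous_on_subset[OF cont]) auto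
  then obtain z where "-1 \<le> z" "z \<le> y" "U z = t" by blast
  then have "z \<in> Z" using y by (simp add: Z_def)
  then have Zne: "Z \<noteq> {}" by blast
  have weights: "b x \<le> sum b Z"
  proof -
    have "b (1 - measure lebesgue (superlevel (\<lambda>y. U y - t) 0)) \<le> sum b Z"
    proof (rule sum_crossing_weights_ge[OF _ _ _ fin Zne _ _ b(2)])
      show "continuous_on UNIV (\<lambda>y. U y - t)" using cont by (intro continuous_intros)
      show "\<exists>d. d \<noteq> 0 \<and> ((\<lambda>y. U y - t) has_real_derivative d) (at z)" if "z \<in> Z" for z
        using Z(2)[OF that] by (intro exI[of _ "d z"]) (auto intro!: derivative_eq_intros)
    qed (use U0 t reg[of 1] in \<open>auto simp: Z_def\<close>)
    moreover have "superlevel (\<lambda>y. U y - t) 0 = superlevel U t" by (auto simp: superlevel_def)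
    ultimately show ?thesis using x_eq by (simp add: \<mu>_def)
  qed
  have slope: "p * (\<Sum>z\<in>Z. 1 / \<bar>d z\<bar>) \<le> 1"
  proof (rule rearrangement_slope_le[OF cont fin Z H(1)])
    show "0 < t" by (rule t)
    show "H (1 - measure lebesgue (superlevel U t)) = t"
      "(H has_real_derivative p) (at (1 - measure lebesgue (superlevel U t)))"
      using x_eq x p by (auto simp: \<mu>_def)
    fix s assume s: "0 \<le> s" "s < t"
    then have "superlevel U t \<subseteq> superlevel U s" by (intro superlevel_antimono) simp
    with ne have "superlevel U s \<noteq> {}" by auto
    then have "s \<le> monotone_rearrangement U (1 - measure lebesgue (superlevel U s))"
      by (intro rearrangement_ge[OF cont s(1)]) auto
    then show "s \<le> H (1 - measure lebesgue (superlevel U s))"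
      using H(2)[of "1 - measure lebesgue (superlevel U s)"] measure_superlevel_le[OF cont, of s] by simp
  qed
  show "G (b x * p) / p \<le> (\<Sum>z\<in>Z. G (b z * \<bar>d z\<bar>) / \<bar>d z\<bar>)"
  proof (rule convex_harmonic_sum_le[OF conv G0 mono fin Zne _ _ _ weights p(2) slope])
    show "0 < \<bar>d z\<bar>" if "z \<in> Z" for z using Z(2)[OF that] by simp
    show "0 \<le> b z" if "z \<in> Z" for z using that by (intro b(1)) (simp add: Z_def)
    show "0 \<le> b x" using x by (intro b(1)) simp
  qed
qed

text \<open>
The inequality for integrands \<open>G\<close> that vanish at zero slope, for functions extended to the whole line and
with Borel functions \<open>U'\<close> and \<open>H'\<close> as derivatives. Both sides are integrals over levels. For \<open>U\<close> the
line is first cut into countably many pieces of injectivity; at a regular level every point of the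
level set lies in a different piece, so the finite sum of \<open>level_inequality\<close> is bounded by the series
over all pieces.
\<close>
theorem rearrangement_inequality_if_zero_at_zero_slope:
  fixes G b :: "real \<Rightarrow> real \<Rightarrow> real" and U U' H H' :: "real \<Rightarrow> real"
  assumes G: "continuous_on UNIV (\<lambda>x. G (fst x) (snd x))" "\<And>v. convex_on {0..} (G v)"
      "\<And>v. G v 0 = 0" "\<And>v. mono_on {0..} (G v)"
    and b: "continuous_on UNIV (\<lambda>x. b (fst x) (snd x))" "\<And>x v. 0 \<le> b x v"
      "\<And>s t v. -1 \<le> s \<Longrightarrow> s \<le> t \<Longrightarrow> t \<le> 1 \<Longrightarrow> b s v + b t v \<ge> b (1 - t + s) v"
    and cont: "continuous_on UNIV U" and U0: "U (-1) = 0"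
    and U': "U' \<in> borel_measurable borel" "\<And>x. U differentiable at x \<Longrightarrow> (U has_real_derivative U' x) (at x)"
    and diffU: "negligible {x\<in>{-1<..<1}. \<not> U differentiable at x}"
    and luzin: "\<And>N. negligible N \<Longrightarrow> N \<subseteq> {-1<..<1} \<Longrightarrow> negligible (U ` N)"
    and H: "mono H" "\<And>x. x \<in> {-1..1} \<Longrightarrow> H x = monotone_rearrangement U x"
    and H': "H' \<in> borel_measurable borel" "\<And>x. H differentiable at x \<Longrightarrow> (H has_real_derivative H' x) (at x)"
  shows "(\<integral>\<^sup>+x\<in>{-1..1}. ennreal (G (H x) (b x (H x) * \<bar>H' x\<bar>)) \<partial>lebesgue)
    \<le> (\<integral>\<^sup>+x\<in>{-1..1}. ennreal (G (U x) (b x (U x) * \<bar>U' x\<bar>)) \<partial>lebesgue)"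
proof -
  define wU where "wU x = G (U x) (b x (U x) * \<bar>U' x\<bar>)" for x
  define wH where "wH x = G (H x) (b x (H x) * \<bar>H' x\<bar>)" for x
  have G_nonneg: "0 \<le> G v q" if "0 \<le> q" for v q
    using mono_onD[OF G(4)[of v], of 0 q] that G(3)[of v] by simp
  have w_nonneg: "0 \<le> wU x" "0 \<le> wH x" for x
    unfolding wU_def wH_def by (intro G_nonneg mult_nonneg_nonneg b(2) abs_ge_zero)+
  have w_meas: "(\<lambda>x. G (V x) (b x (V x) * \<bar>V' x\<bar>)) \<in> borel_measurable lebesgue"
    if "V \<in> borel_measurable borel" "V' \<in> borel_measurable borel" for V V' :: "real \<Rightarrow> real"
  proof -
    have "(\<lambda>x. b x (V x)) \<in> borel_measurable borel"
      by (rule borel_measurable_continuous_Pair[OF _ that(1) b(1)]) simp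
    then have "(\<lambda>x. b x (V x) * \<bar>V' x\<bar>) \<in> borel_measurable borel" using that(2) by measurable
    then have "(\<lambda>x. G (V x) (b x (V x) * \<bar>V' x\<bar>)) \<in> borel_measurable borel"
      by (rule borel_measurable_continuous_Pair[OF that(1) _ G(1)])
    then show ?thesis by (intro measurable_completion) simp
  qed
  have wU_meas: "wU \<in> borel_measurable lebesgue"
    unfolding wU_def[abs_def] by (intro w_meas U' borel_measurable_continuous_onI cont)
  have wH_meas: "wH \<in> borel_measurable lebesgue"
    unfolding wH_def[abs_def] by (intro w_meas H' borel_measurable_mono H)
  define NU where "NU = {x\<in>{-1<..<1}. \<not> U differentiable at x}"
  define D where "D = {-1<..<1} \<inter> {x. U' x \<noteq> 0} - NU"
  define NH where "NH = {x. \<not> H differentiable at x}"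
  define P where "P = {-1<..<1} \<inter> {x. H' x \<noteq> 0} - NH"
  have null: "NU \<in> null_sets lebesgue" "NH \<in> null_sets lebesgue"
    using diffU mono_AE_differentiable[OF H(1)] by (auto simp: NU_def NH_def negligible_iff_null_sets)
  have ne_meas: "{x. V' x \<noteq> 0} \<in> sets lebesgue" if "V' \<in> borel_measurable borel" for V' :: "real \<Rightarrow> real"
  proof -
    have "{x. V' x \<noteq> 0} \<in> sets borel" using that by measurable
    then show ?thesis by simp
  qed
  have D_meas: "D \<in> sets lebesgue" and P_meas: "P \<in> sets lebesgue"
    unfolding D_def P_def using null ne_meas U'(1) H'(1) by (auto intro!: sets.Diff sets.Int)
  have D_der: "-1 < x" "x < 1" "U' x \<noteq> 0" "(U has_real_derivative U' x) (at x)" if "x \<in> D" for x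
    using that U'(2)[of x] by (auto simp: D_def NU_def)
  have P_der: "-1 < x" "x < 1" "0 < H' x" "(H has_real_derivative H' x) (at x)" if "x \<in> P" for x
  proof -
    show der: "-1 < x" "x < 1" "(H has_real_derivative H' x) (at x)"
      using that H'(2)[of x] by (auto simp: P_def NH_def)
    have "mono_on UNIV H" using H(1) by (simp add: mono_on_def mono_def)
    then have "H' x \<ge> 0" by (rule mono_on_imp_deriv_nonneg[OF _ der(3)]) simp
    then show "0 < H' x" using that by (auto simp: P_def)
  qed
  \<comment> \<open>The level density of each piece of injectivity; their sum is integrated over the levels.\<close>
  obtain B where B: "\<And>k :: nat. B k \<in> sets borel" "\<And>k. inj_on U (B k)" "disjoint_family B"
    "\<And>x d. (U has_real_derivative d) (at x) \<Longrightarrow> d \<noteq> 0 \<Longrightarrow> x \<in> (\<Union>k. B k)"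
    using countable_injectivity_partition[OF cont] by blast
  have "\<exists>\<phi>. \<phi> \<in> borel_measurable lebesgue \<and>
      (\<forall>x\<in>D \<inter> B k. \<phi> (U x) = ennreal (wU x / \<bar>U' x\<bar>)) \<and>
      (\<integral>\<^sup>+x. ennreal (wU x) * indicator (D \<inter> B k) x \<partial>lebesgue) = (\<integral>\<^sup>+t. \<phi> t \<partial>lebesgue)" for k
  proof -
    have meas: "D \<inter> B k \<in> sets lebesgue" using D_meas B(1)[of k] by auto
    have inj: "inj_on U (D \<inter> B k)" by (rule inj_on_subset[OF B(2)]) auto
    obtain \<phi> where "\<phi> \<in> borel_measurable lebesgue"
      "\<And>x. x \<in> D \<inter> B k \<Longrightarrow> \<phi> (U x) = ennreal (wU x / \<bar>U' x\<bar>)"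
      "(\<integral>\<^sup>+x. ennreal (wU x) * indicator (D \<inter> B k) x \<partial>lebesgue) = (\<integral>\<^sup>+t. \<phi> t \<partial>lebesgue)"
      by (rule nn_integral_injective_image[OF meas _ inj _ wU_meas w_nonneg(1)])
        (use D_der in blast)+
    then show ?thesis by blast
  qed
  then obtain \<phi> where \<phi>: "\<And>k. \<phi> k \<in> borel_measurable lebesgue"
    "\<And>k x. x \<in> D \<inter> B k \<Longrightarrow> \<phi> k (U x) = ennreal (wU x / \<bar>U' x\<bar>)"
    "\<And>k. (\<integral>\<^sup>+x. ennreal (wU x) * indicator (D \<inter> B k) x \<partial>lebesgue) = (\<integral>\<^sup>+t. \<phi> k t \<partial>lebesgue)"
    by metis
  have D_cover: "x \<in> (\<Union>k. B k)" if "x \<in> D" for x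
    by (rule B(4)[OF D_der(4)[OF that] D_der(3)[OF that]])
  then have DB: "(\<Union>k. D \<inter> B k) = D" by fastforce
  have "(\<integral>\<^sup>+t. (\<Sum>k. \<phi> k t) \<partial>lebesgue) = (\<Sum>k. \<integral>\<^sup>+t. \<phi> k t \<partial>lebesgue)"
    using \<phi>(1) by (rule nn_integral_suminf)
  also have "\<dots> = (\<Sum>k. \<integral>\<^sup>+x. ennreal (wU x) * indicator (D \<inter> B k) x \<partial>lebesgue)"
    by (simp only: \<phi>(3))
  also have "\<dots> = (\<integral>\<^sup>+x. (\<Sum>k. ennreal (wU x) * indicator (D \<inter> B k) x) \<partial>lebesgue)"
  proof (rule nn_integral_suminf[symmetric])
    fix k
    have "D \<inter> B k \<in> sets lebesgue" using D_meas B(1)[of k] by auto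
    then show "(\<lambda>x. ennreal (wU x) * indicator (D \<inter> B k) x) \<in> borel_measurable lebesgue"
      using wU_meas by measurable
  qed
  also have "\<dots> = (\<integral>\<^sup>+x. ennreal (wU x) * indicator D x \<partial>lebesgue)"
  proof (rule nn_integral_cong)
    fix x
    have "disjoint_family (\<lambda>k. D \<inter> B k)" using B(3) by (auto simp: disjoint_family_on_def)
    from suminf_indicator[OF this, of x] show
      "(\<Sum>k. ennreal (wU x) * indicator (D \<inter> B k) x) = ennreal (wU x) * indicator D x"
      unfolding DB by (simp add: ennreal_suminf_cmult)
  qed
  also have "\<dots> \<le> (\<integral>\<^sup>+x\<in>{-1..1}. ennreal (wU x) \<partial>lebesgue)"
    by (intro nn_integral_mono) (auto simp: D_def split: split_indicator)
  finally have lower: "(\<integral>\<^sup>+t. (\<Sum>k. \<phi> k t) \<partial>lebesgue) \<le> (\<integral>\<^sup>+x\<in>{-1..1}. ennreal (wU x) \<partial>lebesgue)" .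
  obtain \<psi> where \<psi>: "\<psi> \<in> borel_measurable lebesgue"
    "\<And>x. x \<in> P \<Longrightarrow> \<psi> (H x) = ennreal (wH x / \<bar>H' x\<bar>)" "\<And>t. t \<notin> H ` P \<Longrightarrow> \<psi> t = 0"
    "(\<integral>\<^sup>+x. ennreal (wH x) * indicator P x \<partial>lebesgue) = (\<integral>\<^sup>+t. \<psi> t \<partial>lebesgue)"
  proof -
    have inj: "inj_on H P"
      by (rule mono_inj_on_pos_derivative[OF H(1)]) (use P_der in blast)
    have nz: "H' x \<noteq> 0" if "x \<in> P" for x
      using P_der(3)[OF that] by simp
    show ?thesis
      by (rule nn_integral_injective_image[OF P_meas P_der(4) inj nz wH_meas w_nonneg(2)])
        (assumption | rule that)+
  qed
  have "(\<integral>\<^sup>+x\<in>{-1..1}. ennreal (wH x) \<partial>lebesgue) = (\<integral>\<^sup>+x. ennreal (wH x) * indicator P x \<partial>lebesgue)"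
  proof (rule nn_integral_cong_AE)
    have "AE x in lebesgue. x \<notin> NH" using null(2) by (rule AE_not_in)
    moreover have "{-1, 1 :: real} \<in> null_sets lebesgue"
      by (simp add: negligible_iff_null_sets[symmetric])
    then have "AE x in lebesgue. x \<notin> {-1, 1 :: real}" by (rule AE_not_in)
    ultimately show "AE x in lebesgue. ennreal (wH x) * indicator {-1..1} x = ennreal (wH x) * indicator P x"
    proof eventually_elim
      case (elim x)
      show ?case
      proof (cases "x \<in> {-1<..<1} \<and> H' x \<noteq> 0")
        case True
        with elim have "x \<in> P" "x \<in> {-1..1}" by (auto simp: P_def)
        then show ?thesis by simp
      next
        case False
        then have "x \<notin> P" by (auto simp: P_def)
        moreover have "x \<notin> {-1..1} \<or> wH x = 0" using False elim G(3) by (auto simp: wH_def)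
        ultimately show ?thesis by auto
      qed
    qed
  qed
  also have "\<dots> = (\<integral>\<^sup>+t. \<psi> t \<partial>lebesgue)" by (rule \<psi>(4))
  also have "\<dots> \<le> (\<integral>\<^sup>+t. (\<Sum>k. \<phi> k t) \<partial>lebesgue)"
  proof (rule nn_integral_mono_AE)
    \<comment> \<open>The exceptional levels are the values at the end points, at points of non-differentiability,
      and at critical points.\<close>
    let ?C = "{x\<in>{-1<..<1}. (U has_real_derivative 0) (at x)}"
    have "negligible (U ` ({-1, 1} \<union> NU \<union> ?C))"
      unfolding image_Un
    proof (intro negligible_Un)
      show "negligible (U ` {-1, 1})" by (intro negligible_finite) simp
      show "negligible (U ` NU)" by (rule luzin) (use diffU in \<open>auto simp: NU_def\<close>)
      show "negligible (U ` ?C)" by (rule negligible_critical_values[where a="-1" and b=1]) auto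
    qed
    then have "AE t in lebesgue. t \<notin> U ` ({-1, 1} \<union> NU \<union> ?C)"
      by (intro AE_not_in) (simp add: negligible_iff_null_sets)
    then show "AE t in lebesgue. \<psi> t \<le> (\<Sum>k. \<phi> k t)"
    proof eventually_elim
      case (elim t)
      show ?case
      proof (cases "t \<in> H ` P")
        case True
        then obtain x where x: "x \<in> P" "H x = t" by auto
        have ZD: "z \<in> D" if "z \<in> {-1..1}" "U z = t" for z
        proof (rule ccontr)
          assume "z \<notin> D"
          then have "z \<in> {-1, 1} \<union> NU \<union> ?C"
            using that(1) U'(2)[of z] by (force simp: D_def NU_def)
          with elim that(2) show False by blast
        qed
        define Z where "Z = {z\<in>{-1..1}. U z = t}"
        have fin: "finite Z" and ineq: "G t (b x t * H' x) / H' x \<le> (\<Sum>z\<in>Z. G t (b z t * \<bar>U' z\<bar>) / \<bar>U' z\<bar>)"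
        proof -
          note reg = D_der[OF ZD]
          note L = level_inequality[of "G t" "\<lambda>x. b x t" U H t U' x "H' x", OF G(2-4) b(2,3) cont U0 H]
          show "finite Z" "G t (b x t * H' x) / H' x \<le> (\<Sum>z\<in>Z. G t (b z t * \<bar>U' z\<bar>) / \<bar>U' z\<bar>)"
            unfolding Z_def by (rule L; (use reg P_der[OF x(1)] x(2) in blast))+
        qed
        have "\<psi> t = ennreal (wH x / H' x)" using \<psi>(2)[OF x(1)] P_der[OF x(1)] x(2) by simp
        also have "\<dots> \<le> ennreal (\<Sum>z\<in>Z. wU z / \<bar>U' z\<bar>)"
        proof (rule ennreal_leI)
          have "wH x / H' x = G t (b x t * H' x) / H' x"
            using x(2) P_der[OF x(1)] by (simp add: wH_def)
          also note ineq
          also have "(\<Sum>z\<in>Z. G t (b z t * \<bar>U' z\<bar>) / \<bar>U' z\<bar>) = (\<Sum>z\<in>Z. wU z / \<bar>U' z\<bar>)"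
            by (intro sum.cong) (auto simp: wU_def Z_def)
          finally show "wH x / H' x \<le> (\<Sum>z\<in>Z. wU z / \<bar>U' z\<bar>)" .
        qed
        also have "\<dots> = (\<Sum>z\<in>Z. ennreal (wU z / \<bar>U' z\<bar>))"
          using w_nonneg by (intro sum_ennreal[symmetric]) auto
        also have "\<dots> \<le> (\<Sum>k. \<phi> k t)"
        proof -
          have "\<exists>k. z \<in> B k" if "z \<in> Z" for z
            using D_cover[OF ZD[of z]] that by (auto simp: Z_def)
          \<comment> \<open>Points of one level set lie in different pieces, so the terms of the sum appear in the series.\<close>
          then obtain \<kappa> where \<kappa>: "\<And>z. z \<in> Z \<Longrightarrow> z \<in> B (\<kappa> z)" by metis
          have "inj_on \<kappa> Z"
          proof (rule inj_onI)
            fix y z assume yz: "y \<in> Z" "z \<in> Z" "\<kappa> y = \<kappa> z"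
            then have "y \<in> B (\<kappa> z)" "z \<in> B (\<kappa> z)" "U y = U z"
              using \<kappa>[of y] \<kappa>[of z] by (auto simp: Z_def)
            then show "y = z" using B(2)[of "\<kappa> z"] by (auto dest: inj_onD)
          qed
          have "(\<Sum>z\<in>Z. ennreal (wU z / \<bar>U' z\<bar>)) = (\<Sum>z\<in>Z. \<phi> (\<kappa> z) t)"
          proof (rule sum.cong)
            fix z assume z: "z \<in> Z"
            then have "z \<in> D \<inter> B (\<kappa> z)" using ZD \<kappa> by (auto simp: Z_def)
            from \<phi>(2)[OF this] z show "ennreal (wU z / \<bar>U' z\<bar>) = \<phi> (\<kappa> z) t" by (simp add: Z_def)
          qed simp
          also have "\<dots> = (\<Sum>k\<in>\<kappa> ` Z. \<phi> k t)"
            using \<open>inj_on \<kappa> Z\<close> by (simp add: sum.reindex)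
          also have "\<dots> \<le> (\<Sum>k. \<phi> k t)"
            using fin by (intro sum_le_suminf) auto
          finally show ?thesis .
        qed
        finally show ?thesis .
      qed (simp add: \<psi>(3))
    qed
  qed
  also note lower
  finally show ?thesis by (simp only: wU_def wH_def)
qed

text \<open>
Replaces \<open>deriv v\<close> by a Borel function and clamps all arguments to the domains of \<open>F\<close> and \<open>a\<close>, which
makes the integrand a composition of functions that are continuous or Borel on the whole line.
\<close>
lemma weighted_functional_eq:
  fixes F a :: "real \<Rightarrow> real \<Rightarrow> real" and v V V' :: "real \<Rightarrow> real"
  assumes V: "\<And>x. x \<in> {-1..1} \<Longrightarrow> V x = v x" and nonneg: "\<And>x. x \<in> {-1..1} \<Longrightarrow> 0 \<le> v x"
    and diff: "negligible {x\<in>{-1<..<1}. \<not> V differentiable at x}"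
    and V': "\<And>x. V differentiable at x \<Longrightarrow> (V has_real_derivative V' x) (at x)"
    and a: "\<And>x v. x \<in> {-1..1} \<Longrightarrow> 0 \<le> v \<Longrightarrow> 0 \<le> a x v"
  shows "weighted_functional F a v =
    (\<integral>\<^sup>+x\<in>{-1..1}. ennreal (F (max 0 (V x)) (max 0 (a (max (-1) (min 1 x)) (max 0 (V x)) * \<bar>V' x\<bar>))) \<partial>lebesgue)"
proof -
  have "weighted_functional F a v = (\<integral>\<^sup>+x\<in>{-1..1}. ennreal (F (v x) (a x (v x) * \<bar>deriv v x\<bar>)) \<partial>lebesgue)"
    unfolding weighted_functional_def by (rule nn_integral_completion[symmetric])
  also have "\<dots> = (\<integral>\<^sup>+x\<in>{-1..1}. ennreal (F (max 0 (V x)) (max 0 (a (max (-1) (min 1 x)) (max 0 (V x)) * \<bar>V' x\<bar>))) \<partial>lebesgue)"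
  proof (rule nn_integral_cong_AE)
    have "{-1, 1 :: real} \<in> null_sets lebesgue"
      by (simp add: negligible_iff_null_sets[symmetric])
    then have "AE x in lebesgue. x \<notin> {-1, 1 :: real}" by (rule AE_not_in)
    moreover have "AE x in lebesgue. x \<notin> {x\<in>{-1<..<1}. \<not> V differentiable at x}"
      using diff by (intro AE_not_in) (simp add: negligible_iff_null_sets)
    ultimately show "AE x in lebesgue.
        ennreal (F (v x) (a x (v x) * \<bar>deriv v x\<bar>)) * indicator {-1..1} x =
        ennreal (F (max 0 (V x)) (max 0 (a (max (-1) (min 1 x)) (max 0 (V x)) * \<bar>V' x\<bar>))) * indicator {-1..1} x"
    proof eventually_elim
      case (elim x)
      show ?case
      proof (cases "x \<in> {-1<..<1}")
        case True
        with elim have "(V has_real_derivative V' x) (at x)" by (intro V') auto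
        then have "(v has_real_derivative V' x) (at x)"
          by (rule has_field_derivative_transform_within_open[of _ _ _ "{-1<..<1}"]) (use True V in auto)
        then have "deriv v x = V' x" by (rule DERIV_imp_deriv)
        moreover have "0 \<le> a x (v x) * \<bar>V' x\<bar>" using a nonneg True by auto
        moreover have "V x = v x" "0 \<le> v x" using V nonneg True by auto
        moreover have "max (-1) (min 1 x) = x" using True by auto
        ultimately show ?thesis by (simp add: max_absorb2)
      next
        case False
        with elim have "x \<notin> {-1..1}" by auto
        then show ?thesis by simp
      qed
    qed
  qed
  finally show ?thesis .
qed

theorem theorem4:
  fixes F a :: "real \<Rightarrow> real \<Rightarrow> real" and u :: "real \<Rightarrow> real"
  assumes "F \<in> integrand_class"
    and "abs_cont_on {-1..1} u"
    and "\<And>x. x \<in> {-1..1} \<Longrightarrow> u x \<ge> 0"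
    and "u (-1) = 0"
    and "continuous_on ({-1..1} \<times> {0..}) (\<lambda>(x, v). a x v)"
    and "\<And>x v. x \<in> {-1..1} \<Longrightarrow> v \<ge> 0 \<Longrightarrow> a x v \<ge> 0"
    and "\<And>s t v. -1 \<le> s \<Longrightarrow> s \<le> t \<Longrightarrow> t \<le> 1 \<Longrightarrow> v \<ge> 0 \<Longrightarrow>
           a s v + a t v \<ge> a (1 - t + s) v"
  shows "weighted_functional F a (monotone_rearrangement u) \<le> weighted_functional F a u"
proof -
  define cl :: "real \<Rightarrow> real" where "cl x = max (-1) (min 1 x)" for x
  have cl: "cl x \<in> {-1..1}" "x \<in> {-1..1} \<Longrightarrow> cl x = x" for x by (auto simp: cl_def)
  have cl_cont: "continuous_on S cl" for S
    unfolding cl_def[abs_def] by (intro continuous_intros)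
  define F' where "F' v p = F (max 0 v) (max 0 p)" for v p
  define G where "G v p = F' v p - F' v 0" for v p
  define b where "b x v = a (cl x) (max 0 v)" for x v
  define U where "U x = u (cl x)" for x
  define H where "H x = monotone_rearrangement u (cl x)" for x
  have F: "continuous_on ({0..} \<times> {0..}) (\<lambda>(v, p). F v p)"
    "\<And>v p. 0 \<le> v \<Longrightarrow> 0 \<le> p \<Longrightarrow> 0 \<le> F v p"
    "\<And>v. 0 \<le> v \<Longrightarrow> convex_on {0..} (F v)" "\<And>v. 0 \<le> v \<Longrightarrow> strict_mono_on {0..} (F v)"
    using assms(1) by (auto simp: integrand_class_def)
  have F'_cont: "continuous_on UNIV (\<lambda>x. F' (fst x) (snd x))"
  proof -
    have "continuous_on UNIV (\<lambda>x::real \<times> real. (\<lambda>(v, p). F v p) (max 0 (fst x), max 0 (snd x)))"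
      by (rule continuous_on_compose2[OF F(1)]) (auto intro!: continuous_intros)
    then show ?thesis by (simp add: F'_def)
  qed
  have F'_0: "continuous_on UNIV (\<lambda>v. F' v 0)"
  proof -
    have "continuous_on UNIV (\<lambda>v::real. (\<lambda>x. F' (fst x) (snd x)) (v, 0))"
      by (rule continuous_on_compose2[OF F'_cont]) (auto intro!: continuous_intros)
    then show ?thesis by simp
  qed
  have G: "continuous_on UNIV (\<lambda>x. G (fst x) (snd x))" "\<And>v. convex_on {0..} (G v)"
      "\<And>v. G v 0 = 0" "\<And>v. mono_on {0..} (G v)"
  proof -
    show "continuous_on UNIV (\<lambda>x. G (fst x) (snd x))"
      unfolding G_def
      by (intro continuous_on_diff F'_cont continuous_on_compose2[OF F'_0]) (auto intro!: continuous_intros)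
    show "G v 0 = 0" for v by (simp add: G_def)
    show "mono_on {0..} (G v)" for v
      using F(4)[of "max 0 v", THEN strict_mono_on_imp_mono_on]
      by (auto simp: mono_on_def G_def F'_def)
    show "convex_on {0..} (G v)" for v
    proof (rule convex_onI)
      fix t x y :: real assume t: "0 < t" "t < 1" and xy: "x \<in> {0..}" "y \<in> {0..}"
      have "F (max 0 v) ((1 - t) *\<^sub>R x + t *\<^sub>R y) \<le> (1 - t) * F (max 0 v) x + t * F (max 0 v) y"
        using convex_onD[OF F(3)[of "max 0 v"], of t x y] t xy by simp
      moreover have "0 \<le> (1 - t) * x + t * y" using t xy by simp
      ultimately show "G v ((1 - t) *\<^sub>R x + t *\<^sub>R y) \<le> (1 - t) * G v x + t * G v y"
        using xy by (simp add: G_def F'_def max_absorb2 algebra_simps)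
    qed simp
  qed
  have b: "continuous_on UNIV (\<lambda>x. b (fst x) (snd x))" "\<And>x v. 0 \<le> b x v"
      "\<And>s t v. -1 \<le> s \<Longrightarrow> s \<le> t \<Longrightarrow> t \<le> 1 \<Longrightarrow> b s v + b t v \<ge> b (1 - t + s) v"
  proof -
    show "continuous_on UNIV (\<lambda>x. b (fst x) (snd x))"
    proof -
      have "continuous_on UNIV (\<lambda>x::real \<times> real. (\<lambda>(x, v). a x v) (cl (fst x), max 0 (snd x)))"
      proof (rule continuous_on_compose2[OF assms(5)])
        have "continuous_on UNIV (\<lambda>x::real \<times> real. cl (fst x))"
          by (rule continuous_on_compose2[OF cl_cont[of UNIV]]) (auto intro!: continuous_intros)
        then show "continuous_on UNIV (\<lambda>x::real \<times> real. (cl (fst x), max 0 (snd x)))"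
          by (intro continuous_intros)
      qed (use cl in auto)
      then show ?thesis by (simp add: b_def)
    qed
    show "0 \<le> b x v" for x v using cl by (simp add: b_def assms(6))
    show "b s v + b t v \<ge> b (1 - t + s) v" if "-1 \<le> s" "s \<le> t" "t \<le> 1" for s t v
      using assms(7)[of s t "max 0 v"] that cl(2)[of s] cl(2)[of t] cl(2)[of "1 - t + s"]
      by (simp add: b_def)
  qed
  have cont_u: "continuous_on {-1..1} u" by (rule abs_cont_on_imp_continuous_on[OF assms(2)])
  have cont: "continuous_on UNIV U"
    unfolding U_def by (rule continuous_on_compose2[OF cont_u cl_cont]) (use cl in auto)
  have U_eq: "U x = u x" if "x \<in> {-1..1}" for x using cl that by (simp add: U_def)
  have U_nonneg: "0 \<le> U x" for x using cl assms(3) by (simp add: U_def)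
  have "superlevel u = superlevel U" by (rule ext) (auto simp: superlevel_def U_eq)
  then have rearr: "monotone_rearrangement u = monotone_rearrangement U"
    by (simp add: monotone_rearrangement_def[abs_def])
  have H: "mono H" "\<And>x. x \<in> {-1..1} \<Longrightarrow> H x = monotone_rearrangement U x"
  proof -
    show "mono H"
      unfolding H_def rearr by (intro monoI rearrangement_mono[OF cont]) (auto simp: cl_def)
    show "H x = monotone_rearrangement U x" if "x \<in> {-1..1}" for x
      using cl that by (simp add: H_def rearr)
  qed
  have U_meas: "U \<in> borel_measurable borel" by (rule borel_measurable_continuous_onI[OF cont])
  have H_meas: "H \<in> borel_measurable borel" by (rule borel_measurable_mono[OF H(1)])
  obtain U' where U': "U' \<in> borel_measurable borel"
    "\<And>x. U differentiable at x \<Longrightarrow> (U has_real_derivative U' x) (at x)"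
    using ex_borel_derivative[OF U_meas] by blast
  obtain H' where H': "H' \<in> borel_measurable borel"
    "\<And>x. H differentiable at x \<Longrightarrow> (H has_real_derivative H' x) (at x)"
    using ex_borel_derivative[OF H_meas] by blast
  have acU: "abs_cont_on {-1..1} U"
  proof -
    have "(\<Sum>(c, d)\<in>S. \<bar>U d - U c\<bar>) = (\<Sum>(c, d)\<in>S. \<bar>u d - u c\<bar>)"
      if "\<forall>(c, d)\<in>S. c < d \<and> {c..d} \<subseteq> {-1..1}" for S
      using that by (intro sum.cong) (auto simp: U_eq)
    then show ?thesis using assms(2) unfolding abs_cont_on_def by (simp cong: conj_cong)
  qed
  note diffU = abs_cont_on_AE_differentiable[OF acU]
  have diffH: "negligible {x\<in>{-1<..<1}. \<not> H differentiable at x}"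
    by (rule negligible_subset[OF mono_AE_differentiable[OF H(1)]]) auto
  have split: "(\<integral>\<^sup>+x\<in>{-1..1}. ennreal (F' (V x) (b x (V x) * \<bar>V' x\<bar>)) \<partial>lebesgue) =
      (\<integral>\<^sup>+x\<in>{-1..1}. ennreal (G (V x) (b x (V x) * \<bar>V' x\<bar>)) \<partial>lebesgue) +
      (\<integral>\<^sup>+x\<in>{-1..1}. ennreal (F' (V x) 0) \<partial>lebesgue)"
    if V: "V \<in> borel_measurable borel" "V' \<in> borel_measurable borel" for V V' :: "real \<Rightarrow> real"
  proof -
    have "(\<lambda>x. b x (V x)) \<in> borel_measurable borel"
      by (rule borel_measurable_continuous_Pair[OF _ V(1) b(1)]) simp
    then have "(\<lambda>x. b x (V x) * \<bar>V' x\<bar>) \<in> borel_measurable borel" using V(2) by measurable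
    then have "(\<lambda>x. G (V x) (b x (V x) * \<bar>V' x\<bar>)) \<in> borel_measurable borel"
      by (rule borel_measurable_continuous_Pair[OF V(1) _ G(1)])
    then have 1: "(\<lambda>x. ennreal (G (V x) (b x (V x) * \<bar>V' x\<bar>)) * indicator {-1..1} x) \<in> borel_measurable lebesgue"
      by (intro measurable_completion) simp
    have "(\<lambda>v. F' v 0) \<in> borel_measurable borel" by (rule borel_measurable_continuous_onI[OF F'_0])
    from measurable_compose[OF V(1) this]
    have 2: "(\<lambda>x. ennreal (F' (V x) 0) * indicator {-1..1} x) \<in> borel_measurable lebesgue"
      by (intro measurable_completion) simp
    have "ennreal (F' (V x) q) = ennreal (G (V x) q) + ennreal (F' (V x) 0)" if "0 \<le> q" for x q
    proof -
      have "0 \<le> G (V x) q" using mono_onD[OF G(4)[of "V x"], of 0 q] G(3)[of "V x"] that by simp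
      moreover have "0 \<le> F' (V x) 0" by (simp add: F'_def F(2))
      ultimately show ?thesis by (simp add: ennreal_plus[symmetric] G_def del: ennreal_plus)
    qed
    then have "ennreal (F' (V x) (b x (V x) * \<bar>V' x\<bar>)) =
        ennreal (G (V x) (b x (V x) * \<bar>V' x\<bar>)) + ennreal (F' (V x) 0)" for x
      using b(2) by (meson mult_nonneg_nonneg abs_ge_zero)
    then show ?thesis by (simp only: distrib_right nn_integral_add[OF 1 2])
  qed
  have wf: "weighted_functional F a v = (\<integral>\<^sup>+x\<in>{-1..1}. ennreal (F' (V x) (b x (V x) * \<bar>V' x\<bar>)) \<partial>lebesgue)"
    if "\<And>x. x \<in> {-1..1} \<Longrightarrow> V x = v x" "\<And>x. x \<in> {-1..1} \<Longrightarrow> 0 \<le> v x"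
      "negligible {x\<in>{-1<..<1}. \<not> V differentiable at x}"
      "\<And>x. V differentiable at x \<Longrightarrow> (V has_real_derivative V' x) (at x)" for v V V'
    unfolding F'_def b_def cl_def by (rule weighted_functional_eq[OF that assms(6)])
  \<comment> \<open>Zero slope: only the distribution of the function matters.\<close>
  have rest: "(\<integral>\<^sup>+x\<in>{-1..1}. ennreal (F' (H x) 0) \<partial>lebesgue) = (\<integral>\<^sup>+x\<in>{-1..1}. ennreal (F' (U x) 0) \<partial>lebesgue)"
    unfolding nn_integral_completion
    by (rule rearrangement_equimeasurable[OF cont U_nonneg H_meas H(2)])
      (use borel_measurable_continuous_onI[OF F'_0] in measurable)
  have "weighted_functional F a (monotone_rearrangement u) =
      (\<integral>\<^sup>+x\<in>{-1..1}. ennreal (F' (H x) (b x (H x) * \<bar>H' x\<bar>)) \<partial>lebesgue)"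
    by (rule wf[OF _ _ diffH H'(2)]) (use H(2) rearrangement_nonneg in \<open>auto simp: rearr\<close>)
  also have "\<dots> \<le> (\<integral>\<^sup>+x\<in>{-1..1}. ennreal (F' (U x) (b x (U x) * \<bar>U' x\<bar>)) \<partial>lebesgue)"
    unfolding split[OF H_meas H'(1)] split[OF U_meas U'(1)] rest
  proof (rule add_right_mono, rule rearrangement_inequality_if_zero_at_zero_slope[OF G b cont _ U' diffU _ H H'])
    show "U (-1) = 0" using U_eq[of "-1"] assms(4) by simp
    show "negligible (U ` N)" if "negligible N" "N \<subseteq> {-1<..<1}" for N
      by (rule abs_cont_on_Luzin[OF acU that])
  qed
  also have "\<dots> = weighted_functional F a u"
    by (rule wf[OF _ _ diffU U'(2), symmetric]) (use U_eq assms(3) in auto)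
  finally show ?thesis .
qed

end
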